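(* Let $G_N$ be a simple $d$-regular graph on $N$ vertices and let $1\le k\le N$ be an integer such that $$\sum_{i=1}^{N-d-1} \binom{N-i}{k-1} < \frac{d+1}{N} \binom{N}{k}.$$ Consider the affinity-scheduling graph model on $G_N$ with arrival rate $\lambda>0$ per vertex and service rates $\mu_1>\mu_2>0$, and a reference system with $N$ servers, total arrival rate $\lambda N$, service rate $\mu_1$ at each server, operating under the JSQ($k$) policy. If the initial configurations satisfy $\overline{Q}^{\mathrm{aff}}_{m+}(0)\le \overline{Q}^{\mathrm{JSQ}(k)}_{m+}(0)$ for all $m\ge 1$, then $$\{(\overline{Q}_{m+}^{\mathrm{aff}}(t))_{m \geq 1}\}_{t \geq 0} \ \leq_{\mathrm{st}}\ \{(\overline{Q}_{m+}^{\mathrm{JSQ}(k)}(t))_{m \geq 1}\}_{t \geq 0}.$$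
   Context: **Affinity-scheduling graph model.** There are $N$ servers, identified with the vertices of $G_N$. At each vertex $v$ jobs arrive according to an independent Poisson process of rate $\lambda$; the selection of primary servers for such a job is the closed neighborhood $S=\{v\}\cup\{\text{neighbors of }v\}$ (of size $d+1$), and the servers in $S^c$ are its secondary servers. A job allocated to a primary server becomes a type I job there (exponential service requirement with rate $\mu_1$); a job allocated to a secondary server becomes a type II job there (exponential service requirement with rate $\mu_2<\mu_1$); all service times are independent. Allocation of a job arriving with selection $S$: 1. If some server in $S$ is completely idle (no jobs), allocate the job as type I to one of these idle servers. 2. Otherwise, if some server in $S^c$ is completely idle, allocate the job as type II to one of these idle servers. 3. Otherwise, allocate the job as type I to the server in $S$ with the smallest number of type I jobs, ties being broken in favor of fewer type II jobs. Any remaining ties are broken by an arbitrary (possibly randomized) rule depending only on the current state and $S$. Each server uses preemptive priority in favor of type I jobs, type I jobs being served in order of arrival: a server with at least one type I job completes type I jobs at rate $\mu_1$; a server with no type I jobs but at least one type II job completes type II jobs at rate $\mu_2$. Initially there are finitely many jobs; initial configurations are deterministic. **JSQ($k$) reference system.** There are $N$ servers with a single type of job; jobs arrive as a Poisson process of rate $\lambda N$; for each arriving job a set of $k$ distinct servers is chosen uniformly at random and the job is assigned to one with the smallest queue length among them (ties broken arbitrarily); each server serves first-come first-served with independent exponential service times of rate $\mu_1$. **Notation.** $\overline{Q}^{\mathrm{aff}}_i(t)$ is the number of servers with at least $i$ type I jobs at time $t$ in the graph model, and $\overline{Q}^{\mathrm{JSQ}(k)}_i(t)$ is the number of servers with at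 least $i$ jobs (including any in service) at time $t$ in the JSQ($k$) system. Put $\overline{Q}_{m+}(t)=\sum_{i\ge m}\overline{Q}_i(t)$ with the corresponding superscript. **Stochastic order.** $\{(X_m(t))_{m\ge1}\}_{t\ge0}\le_{\mathrm{st}}\{(Y_m(t))_{m\ge1}\}_{t\ge0}$ means that the two processes can be constructed on a common probability space (with their respective laws) such that almost surely $X_m(t)\le Y_m(t)$ for all $m\ge1$ and $t\ge0$. *)

theory Defs
  imports "HOL-Probability.Probability"
begin

section \<open>Continuous-time Markov chains\<close>

text \<open>
  A chain is specified by its jump rates \<open>r x y\<close> from \<open>x\<close> to \<open>y \<noteq> x\<close>; the diagonal of \<open>r\<close> plays no
  role. In both systems below the total jump rate out of a state is bounded uniformly in the state
  and each state has finitely many successors, so the Q-matrix determines the transition function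
  (there is no explosion), and \<open>ctmc\<close> determines the law of the process.
\<close>

definition q_matrix :: "('a \<Rightarrow> 'a \<Rightarrow> real) \<Rightarrow> 'a \<Rightarrow> 'a \<Rightarrow> real" where
  "q_matrix r x y = (if x = y then - (\<Sum>\<^sub>\<infinity>z\<in>-{x}. r x z) else r x y)"

definition transition_function :: "('a \<Rightarrow> 'a \<Rightarrow> real) \<Rightarrow> (real \<Rightarrow> 'a \<Rightarrow> 'a pmf) \<Rightarrow> bool" where
  "transition_function r P \<longleftrightarrow>
     (\<forall>x. P 0 x = return_pmf x) \<and>
     (\<forall>s\<ge>0. \<forall>t\<ge>0. \<forall>x. P (s + t) x = bind_pmf (P s x) (P t)) \<and>
     (\<forall>x y. ((\<lambda>t. pmf (P t x) y) has_real_derivative q_matrix r x y) (at 0 within {0..}))"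

definition cadlag_step :: "(real \<Rightarrow> 'a) \<Rightarrow> bool" where
  "cadlag_step f \<longleftrightarrow>
     (\<forall>t\<ge>0. \<forall>\<^sub>F s in at_right t. f s = f t) \<and>
     (\<forall>t>0. \<exists>x. \<forall>\<^sub>F s in at_left t. f s = x)"

text \<open>
  The Markov property is stated in product form, which avoids conditioning on null events.
\<close>

definition ctmc ::
  "'w measure \<Rightarrow> (real \<Rightarrow> 'w \<Rightarrow> 'a) \<Rightarrow> ('a \<Rightarrow> 'a \<Rightarrow> real) \<Rightarrow> 'a \<Rightarrow> bool" where
  "ctmc M X r x0 \<longleftrightarrow>
     prob_space M \<and>
     (\<forall>t\<ge>0. X t \<in> measurable M (count_space UNIV)) \<and>
     (AE \<omega> in M. X 0 \<omega> = x0) \<and>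
     (AE \<omega> in M. cadlag_step (\<lambda>t. X t \<omega>)) \<and>
     (\<exists>P. transition_function r P \<and>
        (\<forall>n t x. 0 \<le> t 0 \<and> (\<forall>i\<le>n. t i \<le> t (Suc i)) \<longrightarrow>
           measure M {\<omega> \<in> space M. \<forall>i\<le>Suc n. X (t i) \<omega> = x i} =
           measure M {\<omega> \<in> space M. \<forall>i\<le>n. X (t i) \<omega> = x i} *
             pmf (P (t (Suc n) - t n) (x n)) (x (Suc n))))"

section \<open>Affinity scheduling on a graph\<close>

definition simple_regular_graph :: "nat \<Rightarrow> ('v::finite \<Rightarrow> 'v \<Rightarrow> bool) \<Rightarrow> bool" where
  "simple_regular_graph d E \<longleftrightarrow> symp E \<and> irreflp E \<and> (\<forall>v. card {w. E v w} = d)"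

definition selection :: "('v \<Rightarrow> 'v \<Rightarrow> bool) \<Rightarrow> 'v \<Rightarrow> 'v set" where
  "selection E v = insert v {w. E v w}"

text \<open>A state assigns to each server its number of type I and its number of type II jobs.\<close>

type_synonym 'v aff_state = "'v \<Rightarrow> nat \<times> nat"

definition idle :: "'v aff_state \<Rightarrow> 'v set" where
  "idle z = {v. z v = (0, 0)}"

text \<open>The servers among which the allocation rule leaves the choice open.\<close>

definition aff_candidates :: "'v aff_state \<Rightarrow> 'v set \<Rightarrow> 'v set" where
  "aff_candidates z S =
     (if S \<inter> idle z \<noteq> {} then S \<inter> idle z
      else if - S \<inter> idle z \<noteq> {} then - S \<inter> idle z
      else {v \<in> S. \<forall>w\<in>S. fst (z v) < fst (z w) \<or>
                          fst (z v) = fst (z w) \<and> snd (z v) \<le> snd (z w)})"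

definition aff_tie_rule ::
  "('v \<Rightarrow> 'v \<Rightarrow> bool) \<Rightarrow> ('v aff_state \<Rightarrow> 'v set \<Rightarrow> 'v pmf) \<Rightarrow> bool" where
  "aff_tie_rule E \<tau> \<longleftrightarrow>
     (\<forall>z v. set_pmf (\<tau> z (selection E v)) \<subseteq> aff_candidates z (selection E v))"

definition aff_assign :: "'v set \<Rightarrow> 'v aff_state \<Rightarrow> 'v \<Rightarrow> 'v aff_state" where
  "aff_assign S z w =
     (if w \<in> S then z(w := (fst (z w) + 1, snd (z w)))
      else z(w := (fst (z w), snd (z w) + 1)))"

definition aff_rate ::
  "('v::finite \<Rightarrow> 'v \<Rightarrow> bool) \<Rightarrow> ('v aff_state \<Rightarrow> 'v set \<Rightarrow> 'v pmf) \<Rightarrow>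
   real \<Rightarrow> real \<Rightarrow> real \<Rightarrow> 'v aff_state \<Rightarrow> 'v aff_state \<Rightarrow> real" where
  "aff_rate E \<tau> lam \<mu>\<^sub>1 \<mu>\<^sub>2 z z' =
     (\<Sum>v\<in>UNIV. lam *
        pmf (map_pmf (aff_assign (selection E v) z) (\<tau> z (selection E v))) z') +
     (\<Sum>v\<in>UNIV.
        if 0 < fst (z v) then \<mu>\<^sub>1 * of_bool (z' = z(v := (fst (z v) - 1, snd (z v))))
        else if 0 < snd (z v) then \<mu>\<^sub>2 * of_bool (z' = z(v := (0, snd (z v) - 1)))
        else 0)"

section \<open>The JSQ(k) system\<close>

definition jsq_tie_rule :: "nat \<Rightarrow> (('s \<Rightarrow> nat) \<Rightarrow> 's set \<Rightarrow> 's pmf) \<Rightarrow> bool" where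
  "jsq_tie_rule k \<sigma> \<longleftrightarrow>
     (\<forall>y S. card S = k \<longrightarrow> set_pmf (\<sigma> y S) \<subseteq> {v \<in> S. \<forall>w\<in>S. y v \<le> y w})"

definition jsq_rate ::
  "nat \<Rightarrow> (('s::finite \<Rightarrow> nat) \<Rightarrow> 's set \<Rightarrow> 's pmf) \<Rightarrow> real \<Rightarrow> real \<Rightarrow>
   ('s \<Rightarrow> nat) \<Rightarrow> ('s \<Rightarrow> nat) \<Rightarrow> real" where
  "jsq_rate k \<sigma> \<Lambda> \<mu> y y' =
     \<Lambda> * pmf (bind_pmf (pmf_of_set {S :: 's set. card S = k})
                (\<lambda>S. map_pmf (\<lambda>w. y(w := y w + 1)) (\<sigma> y S))) y' +
     (\<Sum>v\<in>UNIV. if 0 < y v then \<mu> * of_bool (y' = y(v := y v - 1)) else 0)"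

section \<open>Occupancy tails and stochastic order\<close>

definition Qbar :: "('s::finite \<Rightarrow> nat) \<Rightarrow> nat \<Rightarrow> nat" where
  "Qbar y i = card {v. i \<le> y v}"

text \<open>Only finitely many terms of this sum are nonzero.\<close>

definition Qbar_plus :: "('s::finite \<Rightarrow> nat) \<Rightarrow> nat \<Rightarrow> nat" where
  "Qbar_plus y m = (\<Sum>\<^sub>\<infinity>i\<in>{m..}. Qbar y i)"

text \<open>
  \<open>aff_tails \<dots> M X\<close> and \<open>jsq_tails \<dots> M Y\<close> say that \<open>X\<close> and \<open>Y\<close>, defined on the probability space \<open>M\<close>,
  are the processes of occupancy tails of the respective system; \<open>X t \<omega> m\<close> is the \<open>m\<close>-th
  coordinate at time \<open>t\<close>.
\<close>

definition aff_tails ::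
  "('v::finite \<Rightarrow> 'v \<Rightarrow> bool) \<Rightarrow> ('v aff_state \<Rightarrow> 'v set \<Rightarrow> 'v pmf) \<Rightarrow>
   real \<Rightarrow> real \<Rightarrow> real \<Rightarrow> 'v aff_state \<Rightarrow>
   'w measure \<Rightarrow> (real \<Rightarrow> 'w \<Rightarrow> nat \<Rightarrow> nat) \<Rightarrow> bool" where
  "aff_tails E \<tau> lam \<mu>\<^sub>1 \<mu>\<^sub>2 z0 M X \<longleftrightarrow>
     (\<exists>Z. ctmc M Z (aff_rate E \<tau> lam \<mu>\<^sub>1 \<mu>\<^sub>2) z0 \<and> X = (\<lambda>t \<omega> m. Qbar_plus (fst \<circ> Z t \<omega>) m))"

definition jsq_tails ::
  "nat \<Rightarrow> (('s::finite \<Rightarrow> nat) \<Rightarrow> 's set \<Rightarrow> 's pmf) \<Rightarrow> real \<Rightarrow> real \<Rightarrow> ('s \<Rightarrow> nat) \<Rightarrow>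
   'w measure \<Rightarrow> (real \<Rightarrow> 'w \<Rightarrow> nat \<Rightarrow> nat) \<Rightarrow> bool" where
  "jsq_tails k \<sigma> \<Lambda> \<mu> y0 M Y \<longleftrightarrow>
     (\<exists>Z. ctmc M Z (jsq_rate k \<sigma> \<Lambda> \<mu>) y0 \<and> Y = (\<lambda>t \<omega> m. Qbar_plus (Z t \<omega>) m))"

text \<open>
  The law of a process is represented by the predicate that its realizations satisfy. The sample
  space of the common probability space has to be of a fixed type; \<open>nat \<Rightarrow> real\<close> is a standard Borel
  space large enough to carry every pair of step-function processes with countably many states.
\<close>

definition st_le ::
  "((nat \<Rightarrow> real) measure \<Rightarrow> (real \<Rightarrow> (nat \<Rightarrow> real) \<Rightarrow> nat \<Rightarrow> nat) \<Rightarrow> bool) \<Rightarrow>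
   ((nat \<Rightarrow> real) measure \<Rightarrow> (real \<Rightarrow> (nat \<Rightarrow> real) \<Rightarrow> nat \<Rightarrow> nat) \<Rightarrow> bool) \<Rightarrow> bool"
  (infix \<open>\<le>\<^sub>s\<^sub>t\<close> 50) where
  "\<X> \<le>\<^sub>s\<^sub>t \<Y> \<longleftrightarrow>
     (\<exists>M X Y. prob_space M \<and> \<X> M X \<and> \<Y> M Y \<and>
        (AE \<omega> in M. \<forall>t\<ge>0. \<forall>m\<ge>1. X t \<omega> m \<le> Y t \<omega> m))"

end

theory Submission
  imports Defs
begin

text \<open>
  Both systems have bounded jump rates, so both are uniformized by the same Poisson clock, and a
  pathwise comparison follows once the one-step kernels are coupled so that the order of the
  occupancy tails is preserved. A step can only break the order at a level \<open>m\<close> where the two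
  tail sums are equal. There the order at the neighboring levels compares \<open>Q\<^sub>m\<close> (for departures)
  and \<open>Q\<^sub>m\<^sub>-\<^sub>1\<close> (for arrivals) of the two systems. For departures this suffices. For arrivals
  at \<open>m \<ge> 2\<close> only vertices \<open>v\<close> whose closed neighborhood consists of servers with at least \<open>m - 1\<close>
  jobs matter; unless all servers qualify, there are at most \<open>N - d - 1\<close> of them, and none if fewer
  than \<open>d + 1\<close> servers qualify. The binomial condition says that \<open>1 - (d + 1) / N\<close> is less than
  the probability that JSQ(k) samples only from a given set of \<open>d + 1\<close> servers.
\<close>

section \<open>Quantile couplings\<close>

text \<open>The probability bounds come one tight level at a time, while a coupling has to respect
  all tight levels at once. This is bridged by the fact that each event acts through a single
  natural number, the level it reaches: feeding one uniform variable into both inverse distribution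
  functions turns tail inequalities at the tight levels into simultaneous pointwise implications,
  although no inequality is available at the other levels.

  The coupled steps form a kernel on pairs of states that projects to the kernels of the two
  systems. That each component of the coupled chain is itself Markov with the right rates is a
  lumping statement, so finite-dimensional laws are computed for a chain seen through a projection
  \<open>f\<close>.

  \<open>ctmc\<close> asks for path regularity as well as for laws, and the order is required at all
  times simultaneously. Chains are therefore built explicitly as functions of independent uniform
  variables. Taking \<open>unif01\<close> as a measure on all of \<open>real\<close> matches the
  prescribed sample space \<open>nat \<Rightarrow> real\<close>.\<close>

definition unif01 :: "real measure" where
  "unif01 = uniform_measure lborel {0<..<1}"

lemma sets_unif01 [simp, measurable_cong]: "sets unif01 = sets borel"
  by (simp add: unif01_def)

lemma space_unif01 [simp]: "space unif01 = UNIV"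
  by (simp add: unif01_def)

lemma prob_space_unif01: "prob_space unif01"
  unfolding unif01_def by (rule prob_space_uniform_measure) auto

interpretation unif01: prob_space unif01
  by (rule prob_space_unif01)

lemma nn_integral_unif01:
  assumes [measurable]: "f \<in> borel_measurable borel"
  shows "(\<integral>\<^sup>+u. f u \<partial>unif01) = (\<integral>\<^sup>+u. f u * indicator {0<..<1} u \<partial>lborel)"
  unfolding unif01_def by (subst nn_integral_uniform_measure) (auto simp: divide_ennreal_def)

lemma AE_unif01: "AE u in unif01. 0 < u \<and> u < 1"
  unfolding unif01_def by (subst AE_uniform_measure) auto

lemma emeasure_unif01:
  assumes "A \<in> sets borel"
  shows "emeasure unif01 A = emeasure lborel ({0<..<1} \<inter> A)"
  using assms unfolding unif01_def by (subst emeasure_uniform_measure) (auto simp: divide_ennreal_def)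

lemma emeasure_unif01_Ioc:
  assumes "0 \<le> a" "a \<le> b" "b \<le> 1"
  shows "emeasure unif01 {a<..b} = b - a"
proof -
  have "emeasure unif01 {a<..b} = emeasure lborel ({0<..<1} \<inter> {a<..b})"
    by (rule emeasure_unif01) simp
  \<comment> \<open>For \<open>b = 1\<close> the support omits the right end point, so both cases
    are brought to the open interval.\<close>
  also have "\<dots> = emeasure lborel {a<..<b}"
  proof (cases "b < 1")
    case True
    then have "{0<..<1} \<inter> {a<..b} = {a<..b}" using assms by auto
    then show ?thesis using assms by simp
  next
    case False
    then have "{0<..<1} \<inter> {a<..b} = {a<..<b}" using assms by auto
    then show ?thesis by simp
  qed
  finally show ?thesis using assms by simp
qed

text \<open>Memorylessness: for an exponential clock \<open>- ln u\<close>, conditioning on no ring before time \<open>ln b\<close> and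
  shifting the clock by \<open>ln b\<close> amounts to rescaling \<open>u\<close>.\<close>

lemma nn_integral_unif01_scale:
  assumes [measurable]: "f \<in> borel_measurable borel" and b: "1 \<le> b"
  shows "(\<integral>\<^sup>+u. indicator {u. b * u < 1} u * f (b * u) \<partial>unif01) = ennreal (1 / b) * (\<integral>\<^sup>+u. f u \<partial>unif01)"
proof -
  have "(\<integral>\<^sup>+u. f u \<partial>unif01) = (\<integral>\<^sup>+u. f u * indicator {0<..<1} u \<partial>lborel)"
    by (rule nn_integral_unif01) simp
  also have "\<dots> = ennreal b * (\<integral>\<^sup>+u. f (b * u) * indicator {0<..<1} (b * u) \<partial>lborel)"
    using b by (subst nn_integral_real_affine[where c=b and t=0]) auto
  also have "(\<integral>\<^sup>+u. f (b * u) * indicator {0<..<1} (b * u) \<partial>lborel) =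
      (\<integral>\<^sup>+u. (indicator {u. b * u < 1} u * f (b * u)) * indicator {0<..<1} u \<partial>lborel)"
  proof (intro nn_integral_cong)
    fix u
    have "b * u < 1 \<Longrightarrow> 0 < u \<Longrightarrow> u < 1"
      using b by (smt (verit) mult_le_cancel_right1)
    then show "f (b * u) * indicator {0<..<1} (b * u) =
        (indicator {u. b * u < 1} u * f (b * u)) * indicator {0<..<1} u"
      using b by (auto simp: indicator_def zero_less_mult_iff)
  qed
  also have "\<dots> = (\<integral>\<^sup>+u. indicator {u. b * u < 1} u * f (b * u) \<partial>unif01)"
    by (subst nn_integral_unif01) auto
  finally show ?thesis
    using b by (simp add: mult.assoc[symmetric] flip: ennreal_mult)
qed

text \<open>The generalized inverse of the distribution function. For \<open>u \<ge> 1\<close> the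
  least element need not exist, whence the hypotheses \<open>u < 1\<close> below.\<close>

definition quantile :: "nat pmf \<Rightarrow> real \<Rightarrow> nat" where
  "quantile p u = (LEAST n. u \<le> measure_pmf.prob p {..n})"

lemma ex_cdf_ge:
  assumes "u < 1"
  shows "\<exists>n. u \<le> measure_pmf.prob p {..n::nat}"
proof -
  have "(\<lambda>n. measure_pmf.prob p {..n}) \<longlonglongrightarrow> measure_pmf.prob p (\<Union>n. {..n})"
    by (rule measure_pmf.finite_Lim_measure_incseq) (auto simp: incseq_def)
  moreover have "(\<Union>n. {..n}) = (UNIV :: nat set)" by auto
  ultimately have "(\<lambda>n. measure_pmf.prob p {..n}) \<longlonglongrightarrow> 1" by simp
  then have "\<forall>\<^sub>F n in sequentially. u < measure_pmf.prob p {..n}"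
    using assms by (rule order_tendstoD)
  then show ?thesis by (metis eventually_sequentially less_le order.refl)
qed

lemma quantile_le_iff:
  assumes "u < 1"
  shows "quantile p u \<le> n \<longleftrightarrow> u \<le> measure_pmf.prob p {..n}"
proof
  assume "quantile p u \<le> n"
  then have "measure_pmf.prob p {..quantile p u} \<le> measure_pmf.prob p {..n}"
    by (intro measure_pmf.finite_measure_mono) auto
  moreover have "u \<le> measure_pmf.prob p {..quantile p u}"
    unfolding quantile_def using ex_cdf_ge[OF assms] by (rule LeastI_ex)
  ultimately show "u \<le> measure_pmf.prob p {..n}" by simp
qed (simp add: quantile_def Least_le)

lemma le_quantile_iff:
  assumes "0 < u" "u < 1"
  shows "m \<le> quantile p u \<longleftrightarrow> measure_pmf.prob p {..<m} < u"
proof (cases m)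
  case (Suc n)
  then show ?thesis using quantile_le_iff[OF assms(2), of p n]
    by (auto simp: lessThan_Suc_atMost)
qed (use assms in auto)

lemma prob_lessThan_Suc_pmf:
  "measure_pmf.prob p {..<n} + pmf p n = measure_pmf.prob p {..(n::nat)}"
proof -
  have "measure_pmf.prob p ({..<n} \<union> {n}) = measure_pmf.prob p {..<n} + measure_pmf.prob p {n}"
    by (rule measure_pmf.finite_measure_Union) auto
  also have "{..<n} \<union> {n} = {..n}" by auto
  finally show ?thesis by (simp add: measure_pmf_single)
qed

lemma quantile_eq_iff:
  assumes "0 < u" "u < 1"
  shows "quantile p u = n \<longleftrightarrow> u \<in> {measure_pmf.prob p {..<n} <.. measure_pmf.prob p {..n}}"
  using le_quantile_iff[OF assms, of n p] quantile_le_iff[OF assms(2), of p n] by auto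

lemma quantile_in_set_pmf:
  assumes "0 < u" "u < 1"
  shows "quantile p u \<in> set_pmf p"
  using quantile_eq_iff[OF assms, of p "quantile p u"] prob_lessThan_Suc_pmf[of p "quantile p u"]
  by (auto simp: set_pmf_iff)

lemma quantile_measurable [measurable]: "quantile p \<in> borel \<rightarrow>\<^sub>M count_space UNIV"
  unfolding quantile_def by measurable

lemma emeasure_quantile_eq: "emeasure unif01 {u. quantile p u = n} = pmf p n"
proof -
  have "emeasure unif01 {u. quantile p u = n} =
      emeasure unif01 {measure_pmf.prob p {..<n} <.. measure_pmf.prob p {..n}}"
    using AE_unif01 by (intro emeasure_eq_AE) (auto simp: quantile_eq_iff)
  also have "\<dots> = ennreal (measure_pmf.prob p {..n} - measure_pmf.prob p {..<n})"
    by (intro emeasure_unif01_Ioc measure_pmf.finite_measure_mono) auto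
  also have "\<dots> = pmf p n"
    using prob_lessThan_Suc_pmf[of p n] by (simp add: algebra_simps flip: prob_lessThan_Suc_pmf)
  finally show ?thesis .
qed

lemma distr_quantile: "distr unif01 (count_space UNIV) (quantile p) = measure_pmf p"
  by (rule measure_eqI_countable[where A=UNIV])
     (auto simp: emeasure_distr emeasure_quantile_eq vimage_def emeasure_pmf_single)

section \<open>Discrete laws and threshold couplings\<close>

definition pmf_law :: "'w measure \<Rightarrow> ('w \<Rightarrow> 'a::countable) \<Rightarrow> 'a pmf" where
  "pmf_law M X = Abs_pmf (distr M (count_space UNIV) X)"

lemma measure_pmf_law:
  assumes "prob_space M" and [measurable]: "X \<in> M \<rightarrow>\<^sub>M count_space UNIV"
  shows "measure_pmf (pmf_law M X) = distr M (count_space UNIV) X"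
proof -
  interpret D: prob_space "distr M (count_space UNIV) X"
    using assms by (intro prob_space.prob_space_distr)
  have "AE x in distr M (count_space UNIV) X. D.prob {x} \<noteq> 0"
    by (subst D.AE_support_countable) (auto intro!: exI[of _ UNIV])
  then show ?thesis
    unfolding pmf_law_def by (intro Abs_pmf_inverse) (auto simp: D.prob_space_axioms)
qed

lemma pmf_pmf_law:
  assumes "prob_space M" and [measurable]: "X \<in> M \<rightarrow>\<^sub>M count_space UNIV"
  shows "pmf (pmf_law M X) a = measure M {\<omega> \<in> space M. X \<omega> = a}"
proof -
  have "{\<omega> \<in> space M. X \<omega> = a} = X -` {a} \<inter> space M" by auto
  then show ?thesis
    by (simp add: measure_pmf_law[OF assms] measure_distr flip: measure_pmf_single)
qed

text \<open>Both variables are quantiles of the same \<open>u\<close>. Since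
  \<open>m \<le> quantile p u\<close> means that \<open>u\<close> exceeds the mass of
  \<open>p\<close> below \<open>m\<close>, a tail inequality at \<open>m\<close> yields the
  implication at \<open>m\<close> for every \<open>u\<close> in the unit interval. The coupling does
  not depend on \<open>m\<close>, so all of \<open>A\<close> is served at once without stochastic
  domination of \<open>p\<close> by \<open>q\<close>.\<close>

lemma rel_pmf_thresholds_nat:
  fixes p q :: "nat pmf"
  assumes "\<And>m. m \<in> A \<Longrightarrow> measure_pmf.prob p {m..} \<le> measure_pmf.prob q {m..}"
  shows "rel_pmf (\<lambda>i j. \<forall>m\<in>A. m \<le> i \<longrightarrow> m \<le> j) p q"
proof -
  let ?X = "\<lambda>u. (quantile p u, quantile q u)"
  have [measurable]: "?X \<in> unif01 \<rightarrow>\<^sub>M count_space UNIV"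
    by (subst pair_measure_countable[OF countableI_type countableI_type, of UNIV UNIV, simplified, symmetric]) measurable
  note law = measure_pmf_law[OF prob_space_unif01 this]
  show ?thesis
  proof (rule rel_pmf.intros[where pq = "pmf_law unif01 ?X"])
    have "measure_pmf (map_pmf fst (pmf_law unif01 ?X)) = measure_pmf p"
      by (simp add: map_pmf_rep_eq law distr_distr comp_def distr_quantile)
    then show "map_pmf fst (pmf_law unif01 ?X) = p" by (simp add: measure_pmf_inject)
    have "measure_pmf (map_pmf snd (pmf_law unif01 ?X)) = measure_pmf q"
      by (simp add: map_pmf_rep_eq law distr_distr comp_def distr_quantile)
    then show "map_pmf snd (pmf_law unif01 ?X) = q" by (simp add: measure_pmf_inject)
  next
    fix i j assume "(i, j) \<in> set_pmf (pmf_law unif01 ?X)"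
    then have "unif01.prob {u \<in> space unif01. ?X u = (i, j)} \<noteq> 0"
      by (simp only: set_pmf_iff pmf_pmf_law[OF prob_space_unif01 \<open>?X \<in> _\<close>]) simp
    moreover have "{u \<in> space unif01. ?X u = (i, j)} \<in> sets unif01"
      by measurable
    ultimately have "\<not> (AE u in unif01. ?X u \<noteq> (i, j))"
      using unif01.prob_Collect_eq_0[of "\<lambda>u. ?X u = (i, j)"] by argo
    \<comment> \<open>A pair of positive mass is attained at some \<open>u\<close> strictly between
      0 and 1, where the characterization of quantiles applies.\<close>
    moreover have "AE u in unif01. ?X u \<noteq> (i, j)"
      if "\<And>u. 0 < u \<Longrightarrow> u < 1 \<Longrightarrow> ?X u \<noteq> (i, j)"
      by (rule eventually_mono[OF AE_unif01]) (use that in simp)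
    ultimately obtain u where u: "0 < u" "u < 1" "i = quantile p u" "j = quantile q u"
      by blast
    show "\<forall>m\<in>A. m \<le> i \<longrightarrow> m \<le> j"
    proof safe
      fix m assume m: "m \<in> A" "m \<le> i"
      have "measure_pmf.prob r {..<m} = 1 - measure_pmf.prob r {m..}" for r
        using measure_pmf.prob_compl[of "{m..}" r] by (simp add: Compl_eq_Diff_UNIV[symmetric])
      then show "m \<le> j"
        using assms[OF m(1)] m(2) le_quantile_iff[OF u(1,2), of m] u(3,4) by auto
    qed
  qed
qed

text \<open>The relation sees \<open>a\<close> and \<open>b\<close> only through their levels, so a
  coupling of the laws of the levels lifts to \<open>p\<close> and \<open>q\<close>.\<close>

lemma rel_pmf_thresholds:
  fixes f :: "'a \<Rightarrow> nat" and g :: "'b \<Rightarrow> nat"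
  assumes "\<And>m. m \<in> A \<Longrightarrow> measure_pmf.prob p {a. m \<le> f a} \<le> measure_pmf.prob q {b. m \<le> g b}"
  shows "rel_pmf (\<lambda>a b. \<forall>m\<in>A. m \<le> f a \<longrightarrow> m \<le> g b) p q"
proof -
  have "rel_pmf (\<lambda>i j. \<forall>m\<in>A. m \<le> i \<longrightarrow> m \<le> j) (map_pmf f p) (map_pmf g q)"
    using assms by (intro rel_pmf_thresholds_nat) (auto simp: vimage_def)
  then show ?thesis by (simp add: pmf.rel_map)
qed

section \<open>Uniformized Markov chains\<close>

definition kernel_step :: "('a::countable \<Rightarrow> 'a pmf) \<Rightarrow> 'a \<Rightarrow> real \<Rightarrow> 'a" where
  "kernel_step K x u = from_nat (quantile (map_pmf to_nat (K x)) u)"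

lemma kernel_step_measurable [measurable]: "kernel_step K x \<in> borel \<rightarrow>\<^sub>M count_space UNIV"
  unfolding kernel_step_def by measurable

lemma distr_kernel_step: "distr unif01 (count_space UNIV) (kernel_step K x) = measure_pmf (K x)"
proof -
  have "distr unif01 (count_space UNIV) (kernel_step K x) =
      distr (distr unif01 (count_space UNIV) (quantile (map_pmf to_nat (K x)))) (count_space UNIV) from_nat"
    by (simp add: distr_distr comp_def kernel_step_def[abs_def])
  also have "\<dots> = measure_pmf (map_pmf from_nat (map_pmf to_nat (K x)))"
    by (simp add: distr_quantile map_pmf_rep_eq)
  finally show ?thesis by (simp add: pmf.map_comp comp_def)
qed

lemma nn_integral_kernel_step:
  "(\<integral>\<^sup>+u. g (kernel_step K x u) \<partial>unif01) = (\<integral>\<^sup>+y. g y \<partial>measure_pmf (K x))"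
  by (subst distr_kernel_step[symmetric], subst nn_integral_distr) auto

text \<open>Holds for every \<open>u\<close> in the open interval, not merely almost every one; this
  makes invariance of a set a pathwise statement.\<close>

lemma kernel_step_in_set_pmf:
  assumes "0 < u" "u < 1"
  shows "kernel_step K x u \<in> set_pmf (K x)"
  using quantile_in_set_pmf[OF assms, of "map_pmf to_nat (K x)"] by (auto simp: kernel_step_def)

text \<open>The chain jumps at the points of a rate 1 Poisson process. Its driving noise alternates between
  variables \<open>u\<close>, giving holding times \<open>- ln u\<close>, and variables selecting the next state. Time is
  measured multiplicatively: \<open>b = exp t\<close> is the remaining time budget, and a jump leaves \<open>b * u\<close>.\<close>

definition noise :: "real stream measure" where
  "noise = stream_space unif01"

lemma shd_noise_measurable [measurable]: "shd \<in> borel_measurable noise"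
  using measurable_shd[of unif01] by (simp add: noise_def cong: measurable_cong_sets)

lemma stl_noise_measurable [measurable]: "stl \<in> noise \<rightarrow>\<^sub>M noise"
  by (simp add: noise_def)

lemma SCons_noise_measurable [measurable (raw)]:
  assumes "u \<in> borel_measurable M" "w \<in> M \<rightarrow>\<^sub>M noise"
  shows "(\<lambda>\<omega>. u \<omega> ## w \<omega>) \<in> M \<rightarrow>\<^sub>M noise"
  using assms unfolding noise_def
  by (intro measurable_Stream) (auto cong: measurable_cong_sets)

lemma space_noise [simp]: "space noise = UNIV"
  by (simp add: noise_def space_stream_space)

lemma prob_space_noise: "prob_space noise"
  unfolding noise_def by (rule unif01.prob_space_stream_space)

interpretation noise: prob_space noise
  by (rule prob_space_noise)

lemma nn_integral_noise:
  assumes [measurable]: "f \<in> borel_measurable noise"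
  shows "(\<integral>\<^sup>+\<omega>. f \<omega> \<partial>noise) = (\<integral>\<^sup>+u. (\<integral>\<^sup>+\<omega>. f (u ## \<omega>) \<partial>noise) \<partial>unif01)"
  using assms unfolding noise_def by (rule unif01.nn_integral_stream_space)

text \<open>\<open>n\<close> is fuel. If \<open>over n b \<omega>\<close> holds, the result is the
  state at time \<open>ln b\<close>; otherwise it is the state after \<open>n\<close> jumps.\<close>

primrec run :: "('a::countable \<Rightarrow> 'a pmf) \<Rightarrow> nat \<Rightarrow> 'a \<Rightarrow> real \<Rightarrow> real stream \<Rightarrow> 'a" where
  "run K 0 x b \<omega> = x"
| "run K (Suc n) x b \<omega> =
     (if b * shd \<omega> < 1 then x
      else run K n (kernel_step K x (shd (stl \<omega>))) (b * shd \<omega>) (stl (stl \<omega>)))"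

primrec over :: "nat \<Rightarrow> real \<Rightarrow> real stream \<Rightarrow> bool" where
  "over 0 b \<omega> = False"
| "over (Suc n) b \<omega> = (b * shd \<omega> < 1 \<or> over n (b * shd \<omega>) (stl (stl \<omega>)))"

text \<open>The noise driving the chain after the budget is used up. The holding variable in progress is
  rescaled, so that by memorylessness the result is again noise.\<close>

primrec rest :: "nat \<Rightarrow> real \<Rightarrow> real stream \<Rightarrow> real stream" where
  "rest 0 b \<omega> = \<omega>"
| "rest (Suc n) b \<omega> =
     (if b * shd \<omega> < 1 then (b * shd \<omega>) ## stl \<omega> else rest n (b * shd \<omega>) (stl (stl \<omega>)))"

text \<open>Unspecified on the null set of explosions.\<close>

definition jumps :: "real \<Rightarrow> real stream \<Rightarrow> nat" where
  "jumps b \<omega> = (LEAST n. over n b \<omega>)"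

definition traj :: "('a::countable \<Rightarrow> 'a pmf) \<Rightarrow> 'a \<Rightarrow> real \<Rightarrow> real stream \<Rightarrow> 'a" where
  "traj K x b \<omega> = run K (jumps b \<omega>) x b \<omega>"

definition future :: "real \<Rightarrow> real stream \<Rightarrow> real stream" where
  "future b \<omega> = rest (jumps b \<omega>) b \<omega>"

section \<open>Joint measurability\<close>

lemma run_measurable [measurable (raw)]:
  assumes [measurable]: "x \<in> M \<rightarrow>\<^sub>M count_space UNIV" "b \<in> borel_measurable M" "w \<in> M \<rightarrow>\<^sub>M noise"
  shows "(\<lambda>\<omega>. run K n (x \<omega>) (b \<omega>) (w \<omega>)) \<in> M \<rightarrow>\<^sub>M count_space UNIV"
  using assms
proof (induction n arbitrary: x b w)
  case (Suc n)
  note [measurable] = Suc.prems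
  \<comment> \<open>The state ranges over a countable type, so measurability for each fixed state
    suffices.\<close>
  have [measurable]: "(\<lambda>\<omega>. kernel_step K (x \<omega>) (shd (stl (w \<omega>)))) \<in> M \<rightarrow>\<^sub>M count_space UNIV"
    by (rule measurable_compose_countable[where g=x]) measurable
  have [measurable]: "(\<lambda>\<omega>. run K n (kernel_step K (x \<omega>) (shd (stl (w \<omega>)))) (b \<omega> * shd (w \<omega>)) (stl (stl (w \<omega>))))
      \<in> M \<rightarrow>\<^sub>M count_space UNIV"
    by (rule Suc.IH) measurable
  show ?case by (simp only: run.simps) measurable
qed simp

lemma over_measurable [measurable (raw)]:
  assumes "b \<in> borel_measurable M" "w \<in> M \<rightarrow>\<^sub>M noise"
  shows "Measurable.pred M (\<lambda>\<omega>. over n (b \<omega>) (w \<omega>))"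
  using assms
proof (induction n arbitrary: b w)
  case (Suc n)
  note [measurable] = Suc.prems
  have [measurable]: "Measurable.pred M (\<lambda>\<omega>. over n (b \<omega> * shd (w \<omega>)) (stl (stl (w \<omega>))))"
    by (rule Suc.IH) measurable
  show ?case by (simp only: over.simps) measurable
qed simp

lemma rest_measurable [measurable (raw)]:
  assumes "b \<in> borel_measurable M" "w \<in> M \<rightarrow>\<^sub>M noise"
  shows "(\<lambda>\<omega>. rest n (b \<omega>) (w \<omega>)) \<in> M \<rightarrow>\<^sub>M noise"
  using assms
proof (induction n arbitrary: b w)
  case (Suc n)
  note [measurable] = Suc.prems
  have [measurable]: "(\<lambda>\<omega>. rest n (b \<omega> * shd (w \<omega>)) (stl (stl (w \<omega>)))) \<in> M \<rightarrow>\<^sub>M noise"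
    by (rule Suc.IH) measurable
  show ?case by (simp only: rest.simps) measurable
qed simp

lemma jumps_measurable [measurable]: "jumps b \<in> noise \<rightarrow>\<^sub>M count_space UNIV"
  unfolding jumps_def by measurable

lemma traj_measurable [measurable]: "traj K x b \<in> noise \<rightarrow>\<^sub>M count_space UNIV"
  unfolding traj_def by (rule measurable_compose_countable[where g="jumps b"]) measurable

lemma future_measurable [measurable]: "future b \<in> noise \<rightarrow>\<^sub>M noise"
  unfolding future_def by (rule measurable_compose_countable[where g="jumps b"]) measurable

section \<open>Fuel, budgets and the flow property\<close>

lemma over_Suc: "over n b \<omega> \<Longrightarrow> over (Suc n) b \<omega>"
  by (induction n arbitrary: b \<omega>) auto

lemma over_mono: "over m b \<omega> \<Longrightarrow> m \<le> n \<Longrightarrow> over n b \<omega>"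
  by (rule lift_Suc_mono_le[where f="\<lambda>n. over n b \<omega>", unfolded le_bool_def, THEN mp]) (auto dest: over_Suc)

lemma over_antimono_budget: "over n c \<omega> \<Longrightarrow> 0 < b \<Longrightarrow> b \<le> c \<Longrightarrow> over n b \<omega>"
proof (induction n arbitrary: b c \<omega>)
  case (Suc n)
  show ?case
  proof (cases "b * shd \<omega> < 1")
    case False
    \<comment> \<open>The noise is an arbitrary real stream here; positivity of
      \<open>shd \<omega>\<close>, needed to compare the scaled budgets, comes from the failed
      test.\<close>
    then have "0 < b * shd \<omega>" by simp
    then have "0 < shd \<omega>" using Suc.prems by (simp add: zero_less_mult_iff)
    then have "b * shd \<omega> \<le> c * shd \<omega>" using Suc.prems by simp
    with False Suc show ?thesis using \<open>0 < b * shd \<omega>\<close> by auto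
  qed simp
qed simp

lemma run_eq_run: "over m b \<omega> \<Longrightarrow> m \<le> n \<Longrightarrow> run K n x b \<omega> = run K m x b \<omega>"
proof (induction m arbitrary: n x b \<omega>)
  case (Suc m)
  then show ?case by (cases n) auto
qed simp

lemma rest_eq_rest: "over m b \<omega> \<Longrightarrow> m \<le> n \<Longrightarrow> rest n b \<omega> = rest m b \<omega>"
proof (induction m arbitrary: n b \<omega>)
  case (Suc m)
  then show ?case by (cases n) auto
qed simp

lemma over_jumps: "over n b \<omega> \<Longrightarrow> over (jumps b \<omega>) b \<omega> \<and> jumps b \<omega> \<le> n"
  unfolding jumps_def by (auto intro: LeastI Least_le)

lemma traj_eq_run: "over n b \<omega> \<Longrightarrow> traj K x b \<omega> = run K n x b \<omega>"
  unfolding traj_def using over_jumps run_eq_run by metis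

lemma future_eq_rest: "over n b \<omega> \<Longrightarrow> future b \<omega> = rest n b \<omega>"
  unfolding future_def using over_jumps rest_eq_rest by metis

text \<open>The interrupted holding variable is stored as \<open>b * shd \<omega>\<close>, so the
  later test \<open>c * (b * shd \<omega>) < 1\<close> is the original test for the budget
  \<open>b * c\<close>. This is the purely pathwise half of the Markov property.\<close>

lemma run_flow:
  assumes "over n (b * c) \<omega>" "0 < b" "1 \<le> c"
  shows "run K n x (b * c) \<omega> = run K n (run K n x b \<omega>) c (rest n b \<omega>)
    \<and> over n c (rest n b \<omega>)"
  using assms
proof (induction n arbitrary: x b \<omega>)
  case (Suc n)
  have eq: "b * c * shd \<omega> = c * (b * shd \<omega>)" by (simp add: mult_ac)
  show ?case
  proof (cases "b * shd \<omega> < 1")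
    case True
    then show ?thesis using Suc.prems by (auto simp: eq)
  next
    case False
    then have "\<not> c * (b * shd \<omega>) < 1"
      using \<open>1 \<le> c\<close> by (smt (verit) mult_le_cancel_right1)
    then have ov: "over n (b * shd \<omega> * c) (stl (stl \<omega>))"
      using Suc.prems(1) by (simp add: eq mult_ac)
    note IH = Suc.IH[OF ov _ \<open>1 \<le> c\<close>]
    let ?x = "kernel_step K x (shd (stl \<omega>))"
    let ?r = "rest n (b * shd \<omega>) (stl (stl \<omega>))"
    have "over n c ?r" "run K n ?x (b * shd \<omega> * c) (stl (stl \<omega>)) =
        run K n (run K n ?x (b * shd \<omega>) (stl (stl \<omega>))) c ?r"
      using IH False by auto
    \<comment> \<open>The first jump has used one unit of fuel, so the induction hypothesis speaks
      of fuel \<open>n\<close> and the goal of \<open>Suc n\<close>.\<close>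
    moreover have "run K (Suc n) y c ?r = run K n y c ?r" for y
      using \<open>over n c ?r\<close> by (intro run_eq_run) auto
    ultimately show ?thesis
      using False \<open>\<not> c * (b * shd \<omega>) < 1\<close> over_Suc
      by (simp add: eq mult_ac del: run.simps(2) over.simps(2)) (simp add: mult_ac)
  qed
qed simp

lemma traj_flow:
  assumes "over n (b * c) \<omega>" "0 < b" "1 \<le> c"
  shows "traj K x (b * c) \<omega> = traj K (traj K x b \<omega>) c (future b \<omega>)"
proof -
  have "over n b \<omega>"
    using assms by (intro over_antimono_budget[OF assms(1)]) auto
  moreover note run_flow[OF assms, of K x]
  ultimately show ?thesis
    using assms(1) by (metis traj_eq_run future_eq_rest)
qed

lemma measurable_countable_kernel:
  fixes \<phi> :: "'a::countable \<Rightarrow> 'b \<Rightarrow> 'c"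
  assumes "\<And>y. \<phi> y \<in> N \<rightarrow>\<^sub>M L" "y \<in> M \<rightarrow>\<^sub>M count_space UNIV" "w \<in> M \<rightarrow>\<^sub>M N"
  shows "(\<lambda>\<omega>. \<phi> (y \<omega>) (w \<omega>)) \<in> M \<rightarrow>\<^sub>M L"
  by (rule measurable_compose_countable[OF _ assms(2)]) (rule measurable_compose[OF assms(3,1)])

section \<open>Absence of explosion\<close>

lemma nn_integral_noise2:
  assumes [measurable]: "f \<in> borel_measurable noise"
  shows "(\<integral>\<^sup>+\<omega>. f \<omega> \<partial>noise) =
    (\<integral>\<^sup>+u. (\<integral>\<^sup>+v. (\<integral>\<^sup>+\<omega>. f (u ## v ## \<omega>) \<partial>noise) \<partial>unif01) \<partial>unif01)"
  by (subst nn_integral_noise, measurable) (intro nn_integral_cong, subst nn_integral_noise, auto)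

lemma nn_integral_unif01_linear_le:
  assumes "0 \<le> c"
  shows "(\<integral>\<^sup>+u. ennreal (c * u) \<partial>unif01) \<le> ennreal (c / 2)"
proof -
  have "(\<integral>\<^sup>+u. ennreal (c * u) \<partial>unif01) = (\<integral>\<^sup>+u. ennreal (c * u) * indicator {0<..<1} u \<partial>lborel)"
    by (rule nn_integral_unif01) simp
  also have "\<dots> \<le> (\<integral>\<^sup>+u. ennreal (c * u) * indicator {0..1} u \<partial>lborel)"
    by (intro nn_integral_mono) (auto simp: indicator_def)
  also have "\<dots> = ennreal (c * 1\<^sup>2 / 2 - c * 0\<^sup>2 / 2)"
    using assms by (intro nn_integral_FTC_Icc) (auto intro!: derivative_eq_intros)
  finally show ?thesis by simp
qed

lemma not_over_sets: "{\<omega>. \<not> over n b \<omega>} \<in> sets noise"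
proof -
  have "{\<omega> \<in> space noise. \<not> over n b \<omega>} \<in> sets noise" by measurable
  then show ?thesis by simp
qed

text \<open>Markov's inequality in disguise: after \<open>n\<close> jumps the budget left is
  \<open>b\<close> times a product of \<open>n\<close> independent uniform variables, each of mean
  1/2, and the budget lasts only if this is at least 1. In the induction, the first variable
  \<open>u\<close> passes the budget \<open>b * u\<close> on and is then averaged.\<close>

lemma emeasure_not_over:
  assumes "1 \<le> b"
  shows "emeasure noise {\<omega>. \<not> over n b \<omega>} \<le> ennreal (b * (1 / 2) ^ n)"
  using assms
proof (induction n arbitrary: b)
  case 0
  then show ?case by (simp add: noise.emeasure_space_1[simplified])
next
  case (Suc n)
  have "emeasure noise {\<omega>. \<not> over (Suc n) b \<omega>} = (\<integral>\<^sup>+\<omega>. indicator {\<omega>. \<not> over (Suc n) b \<omega>} \<omega> \<partial>noise)"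
    by (rule nn_integral_indicator[symmetric, OF not_over_sets])
  also have "\<dots> = (\<integral>\<^sup>+u. (\<integral>\<^sup>+v. (\<integral>\<^sup>+\<omega>. indicator {\<omega>. \<not> over (Suc n) b \<omega>} (u ## v ## \<omega>) \<partial>noise) \<partial>unif01) \<partial>unif01)"
    by (intro nn_integral_noise2 borel_measurable_indicator not_over_sets)
  also have "\<dots> \<le> (\<integral>\<^sup>+u. ennreal (b * (1 / 2) ^ n * u) \<partial>unif01)"
  proof (intro nn_integral_mono)
    fix u
    have "(\<integral>\<^sup>+\<omega>. indicator {\<omega>. \<not> over (Suc n) b \<omega>} (u ## v ## \<omega>) \<partial>noise) \<le> ennreal (b * (1 / 2) ^ n * u)" for v
    proof (cases "b * u < 1")
      case False
      have "(\<integral>\<^sup>+\<omega>. indicator {\<omega>. \<not> over (Suc n) b \<omega>} (u ## v ## \<omega>) \<partial>noise) =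
          (\<integral>\<^sup>+\<omega>. indicator {\<omega>. \<not> over n (b * u) \<omega>} \<omega> \<partial>noise)"
        using False by (intro nn_integral_cong) (auto simp: indicator_def)
      also have "\<dots> = emeasure noise {\<omega>. \<not> over n (b * u) \<omega>}"
        by (rule nn_integral_indicator[OF not_over_sets])
      also have "\<dots> \<le> ennreal (b * u * (1 / 2) ^ n)"
        using False by (intro Suc.IH) simp
      finally show ?thesis by (simp add: mult_ac)
    qed (simp add: indicator_def)
    then have "(\<integral>\<^sup>+v. (\<integral>\<^sup>+\<omega>. indicator {\<omega>. \<not> over (Suc n) b \<omega>} (u ## v ## \<omega>) \<partial>noise) \<partial>unif01)
        \<le> (\<integral>\<^sup>+v. ennreal (b * (1 / 2) ^ n * u) \<partial>unif01)"
      by (intro nn_integral_mono)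
    then show "(\<integral>\<^sup>+v. (\<integral>\<^sup>+\<omega>. indicator {\<omega>. \<not> over (Suc n) b \<omega>} (u ## v ## \<omega>) \<partial>noise) \<partial>unif01)
        \<le> ennreal (b * (1 / 2) ^ n * u)"
      by (simp add: unif01.emeasure_space_1[simplified])
  qed
  also have "\<dots> \<le> ennreal (b * (1 / 2) ^ n / 2)"
    using Suc.prems by (intro nn_integral_unif01_linear_le) simp
  finally show ?case by (simp add: mult_ac)
qed

lemma AE_over:
  assumes "1 \<le> b"
  shows "AE \<omega> in noise. \<exists>n. over n b \<omega>"
proof (rule AE_I)
  let ?N = "{\<omega>. \<forall>n. \<not> over n b \<omega>}"
  have "{\<omega> \<in> space noise. \<forall>n. \<not> over n b \<omega>} \<in> sets noise" by measurable
  then show "?N \<in> sets noise" by simp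
  have "emeasure noise ?N \<le> ennreal (b * (1 / 2) ^ n)" for n
  proof -
    have "emeasure noise ?N \<le> emeasure noise {\<omega>. \<not> over n b \<omega>}"
      by (intro emeasure_mono not_over_sets) auto
    also note emeasure_not_over[OF assms]
    finally show ?thesis .
  qed
  moreover have "(\<lambda>n. ennreal (b * (1 / 2) ^ n)) \<longlonglongrightarrow> ennreal (b * 0)"
    by (intro tendsto_intros LIMSEQ_power_zero) auto
  ultimately have "emeasure noise ?N \<le> ennreal (b * 0)"
    by (intro LIMSEQ_le_const) auto
  then show "emeasure noise ?N = 0" by simp
qed auto

text \<open>Carries identities proved by induction on fuel over to \<open>traj\<close> and
  \<open>future\<close>: the events \<open>over n b\<close> increase to an event of full measure, so
  monotone convergence applies.\<close>

lemma nn_integral_SUP_over: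
  assumes [measurable]: "f \<in> borel_measurable noise" and "1 \<le> b"
  shows "(\<integral>\<^sup>+\<omega>. f \<omega> \<partial>noise) = (SUP n. \<integral>\<^sup>+\<omega>. (if over n b \<omega> then f \<omega> else 0) \<partial>noise)"
proof -
  have "(\<integral>\<^sup>+\<omega>. f \<omega> \<partial>noise) = (\<integral>\<^sup>+\<omega>. (SUP n. if over n b \<omega> then f \<omega> else 0) \<partial>noise)"
  proof (rule nn_integral_cong_AE, use AE_over[OF \<open>1 \<le> b\<close>] in eventually_elim)
    case (elim \<omega>)
    then obtain n where "over n b \<omega>" by blast
    then have "f \<omega> \<le> (SUP n. if over n b \<omega> then f \<omega> else 0)"
      by (intro SUP_upper2[of n]) auto
    then show ?case by (intro antisym SUP_least) auto
  qed
  also have "\<dots> = (SUP n. \<integral>\<^sup>+\<omega>. (if over n b \<omega> then f \<omega> else 0) \<partial>noise)"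
    by (intro nn_integral_monotone_convergence_SUP)
       (auto simp: incseq_def le_fun_def dest: over_mono)
  finally show ?thesis .
qed

section \<open>Markov property and lumping\<close>

lemma nn_integral_noise_Suc:
  fixes g :: "real stream \<Rightarrow> ennreal" and h :: "real \<Rightarrow> real \<Rightarrow> real stream \<Rightarrow> ennreal"
  assumes [measurable]: "g \<in> borel_measurable noise"
    "(\<lambda>\<omega>. h (b * shd \<omega>) (shd (stl \<omega>)) (stl (stl \<omega>))) \<in> borel_measurable noise"
    and b: "1 \<le> b"
  shows "(\<integral>\<^sup>+\<omega>. (if b * shd \<omega> < 1 then g ((b * shd \<omega>) ## stl \<omega>)
      else h (b * shd \<omega>) (shd (stl \<omega>)) (stl (stl \<omega>))) \<partial>noise) =
    ennreal (1 / b) * (\<integral>\<^sup>+\<omega>. g \<omega> \<partial>noise) +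
    (\<integral>\<^sup>+u. (\<integral>\<^sup>+v. (\<integral>\<^sup>+\<omega>. (if b * u < 1 then 0 else h (b * u) v \<omega>) \<partial>noise) \<partial>unif01) \<partial>unif01)"
proof -
  let ?G = "\<lambda>\<omega>. (if b * shd \<omega> < 1 then g ((b * shd \<omega>) ## stl \<omega>) else 0)"
  let ?H = "\<lambda>\<omega>. (if b * shd \<omega> < 1 then 0 else h (b * shd \<omega>) (shd (stl \<omega>)) (stl (stl \<omega>)))"
  have "(\<integral>\<^sup>+\<omega>. (if b * shd \<omega> < 1 then g ((b * shd \<omega>) ## stl \<omega>)
      else h (b * shd \<omega>) (shd (stl \<omega>)) (stl (stl \<omega>))) \<partial>noise) = (\<integral>\<^sup>+\<omega>. ?G \<omega> + ?H \<omega> \<partial>noise)"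
    by (intro nn_integral_cong) auto
  also have "\<dots> = (\<integral>\<^sup>+\<omega>. ?G \<omega> \<partial>noise) + (\<integral>\<^sup>+\<omega>. ?H \<omega> \<partial>noise)"
    by (rule nn_integral_add) measurable
  also have "(\<integral>\<^sup>+\<omega>. ?G \<omega> \<partial>noise) = (\<integral>\<^sup>+u. indicator {u. b * u < 1} u * (\<integral>\<^sup>+\<omega>. g ((b * u) ## \<omega>) \<partial>noise) \<partial>unif01)"
    by (subst nn_integral_noise, measurable) (auto intro!: nn_integral_cong simp: indicator_def)
  \<comment> \<open>Memorylessness: \<open>1 / b\<close> is the probability of no ring before time
    \<open>ln b\<close>, and given this event \<open>b * u\<close> is again uniform.\<close>
  also have "\<dots> = ennreal (1 / b) * (\<integral>\<^sup>+u. (\<integral>\<^sup>+\<omega>. g (u ## \<omega>) \<partial>noise) \<partial>unif01)"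
    by (rule nn_integral_unif01_scale[where f="\<lambda>u. \<integral>\<^sup>+\<omega>. g (u ## \<omega>) \<partial>noise"]) (measurable, use b in simp)
  also have "(\<integral>\<^sup>+u. (\<integral>\<^sup>+\<omega>. g (u ## \<omega>) \<partial>noise) \<partial>unif01) = (\<integral>\<^sup>+\<omega>. g \<omega> \<partial>noise)"
    by (subst nn_integral_noise) auto
  also have "(\<integral>\<^sup>+\<omega>. ?H \<omega> \<partial>noise) =
      (\<integral>\<^sup>+u. (\<integral>\<^sup>+v. (\<integral>\<^sup>+\<omega>. (if b * u < 1 then 0 else h (b * u) v \<omega>) \<partial>noise) \<partial>unif01) \<partial>unif01)"
    by (subst nn_integral_noise2) (simp_all cong: if_cong)
  finally show ?thesis .
qed

text \<open>Replacing the leftover noise by an independent copy expresses that it is fresh noise,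
  independent of the current state. If the first ring comes too late, this is memorylessness;
  otherwise, with the first two variables fixed, the induction hypothesis applies to the remaining
  budget \<open>b * u\<close>, which is at least 1.\<close>

lemma markov_run:
  fixes \<phi> :: "'a::countable \<Rightarrow> real stream \<Rightarrow> ennreal"
  assumes \<phi>: "\<And>y. \<phi> y \<in> borel_measurable noise" and "1 \<le> b"
  shows "(\<integral>\<^sup>+\<omega>. (if over n b \<omega> then \<phi> (run K n x b \<omega>) (rest n b \<omega>) else 0) \<partial>noise) =
    (\<integral>\<^sup>+\<omega>. (if over n b \<omega> then \<integral>\<^sup>+\<omega>'. \<phi> (run K n x b \<omega>) \<omega>' \<partial>noise else 0) \<partial>noise)"
  using \<open>1 \<le> b\<close>
proof (induction n arbitrary: x b)
  case (Suc n)
  let ?h = "\<lambda>b v \<omega>. if over n b \<omega>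
    then \<phi> (run K n (kernel_step K x v) b \<omega>) (rest n b \<omega>) else 0"
  let ?h' = "\<lambda>b v \<omega>. if over n b \<omega>
    then \<integral>\<^sup>+\<omega>'. \<phi> (run K n (kernel_step K x v) b \<omega>) \<omega>' \<partial>noise else 0"
  note [measurable] = \<phi> and [measurable (raw)] = measurable_countable_kernel[OF \<phi>]
  have "(\<integral>\<^sup>+\<omega>. (if over (Suc n) b \<omega> then \<phi> (run K (Suc n) x b \<omega>) (rest (Suc n) b \<omega>) else 0) \<partial>noise) =
    (\<integral>\<^sup>+\<omega>. (if b * shd \<omega> < 1 then \<phi> x ((b * shd \<omega>) ## stl \<omega>)
      else ?h (b * shd \<omega>) (shd (stl \<omega>)) (stl (stl \<omega>))) \<partial>noise)"
    by (intro nn_integral_cong) auto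
  also have "\<dots> = ennreal (1 / b) * (\<integral>\<^sup>+\<omega>. \<phi> x \<omega> \<partial>noise) +
    (\<integral>\<^sup>+u. (\<integral>\<^sup>+v. (\<integral>\<^sup>+\<omega>. (if b * u < 1 then 0 else ?h (b * u) v \<omega>) \<partial>noise) \<partial>unif01) \<partial>unif01)"
    using Suc.prems by (intro nn_integral_noise_Suc) measurable
  also have "(\<integral>\<^sup>+u. (\<integral>\<^sup>+v. (\<integral>\<^sup>+\<omega>. (if b * u < 1 then 0 else ?h (b * u) v \<omega>) \<partial>noise) \<partial>unif01) \<partial>unif01) =
    (\<integral>\<^sup>+u. (\<integral>\<^sup>+v. (\<integral>\<^sup>+\<omega>. (if b * u < 1 then 0 else ?h' (b * u) v \<omega>) \<partial>noise) \<partial>unif01) \<partial>unif01)"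
    (is "?L = ?R")
  proof (rule nn_integral_cong, rule nn_integral_cong)
    fix u v
    show "(\<integral>\<^sup>+\<omega>. (if b * u < 1 then 0 else ?h (b * u) v \<omega>) \<partial>noise) =
        (\<integral>\<^sup>+\<omega>. (if b * u < 1 then 0 else ?h' (b * u) v \<omega>) \<partial>noise)"
    proof (cases "b * u < 1")
      case False
      then show ?thesis by (simp only: if_False) (rule Suc.IH, simp)
    qed simp
  qed
  also have "(\<integral>\<^sup>+\<omega>. \<phi> x \<omega> \<partial>noise) = (\<integral>\<^sup>+\<omega>. (\<integral>\<^sup>+\<omega>'. \<phi> x \<omega>' \<partial>noise) \<partial>noise)"
    by (simp add: noise.emeasure_space_1[simplified])
  also have "ennreal (1 / b) * \<dots> + ?R =
    (\<integral>\<^sup>+\<omega>. (if b * shd \<omega> < 1 then \<integral>\<^sup>+\<omega>'. \<phi> x \<omega>' \<partial>noise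
      else ?h' (b * shd \<omega>) (shd (stl \<omega>)) (stl (stl \<omega>))) \<partial>noise)"
    by (rule nn_integral_noise_Suc[where g="\<lambda>_. \<integral>\<^sup>+\<omega>'. \<phi> x \<omega>' \<partial>noise" and h="?h'", symmetric])
      (measurable, use Suc.prems in simp)
  also have "\<dots> = (\<integral>\<^sup>+\<omega>. (if over (Suc n) b \<omega> then \<integral>\<^sup>+\<omega>'. \<phi> (run K (Suc n) x b \<omega>) \<omega>' \<partial>noise else 0) \<partial>noise)"
    by (intro nn_integral_cong) auto
  finally show ?case .
qed simp

lemma markov_traj:
  fixes \<phi> :: "'a::countable \<Rightarrow> real stream \<Rightarrow> ennreal"
  assumes \<phi>: "\<And>y. \<phi> y \<in> borel_measurable noise" and "1 \<le> b"
  shows "(\<integral>\<^sup>+\<omega>. \<phi> (traj K x b \<omega>) (future b \<omega>) \<partial>noise) =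
    (\<integral>\<^sup>+\<omega>. \<integral>\<^sup>+\<omega>'. \<phi> (traj K x b \<omega>) \<omega>' \<partial>noise \<partial>noise)"
proof -
  note [measurable] = \<phi> and [measurable (raw)] = measurable_countable_kernel[OF \<phi>]
  have eq1: "(if over n b \<omega> then \<phi> (traj K x b \<omega>) (future b \<omega>) else 0) =
      (if over n b \<omega> then \<phi> (run K n x b \<omega>) (rest n b \<omega>) else 0)" for n \<omega>
    by (simp add: traj_eq_run future_eq_rest)
  have eq2: "(if over n b \<omega> then \<integral>\<^sup>+\<omega>'. \<phi> (traj K x b \<omega>) \<omega>' \<partial>noise else 0) =
      (if over n b \<omega> then \<integral>\<^sup>+\<omega>'. \<phi> (run K n x b \<omega>) \<omega>' \<partial>noise else 0)" for n \<omega>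
    by (simp add: traj_eq_run)
  have "(\<integral>\<^sup>+\<omega>. \<phi> (traj K x b \<omega>) (future b \<omega>) \<partial>noise) =
      (SUP n. \<integral>\<^sup>+\<omega>. (if over n b \<omega> then \<phi> (run K n x b \<omega>) (rest n b \<omega>) else 0) \<partial>noise)"
    by (subst nn_integral_SUP_over[OF _ \<open>1 \<le> b\<close>], measurable) (simp only: eq1)
  also have "\<dots> = (SUP n. \<integral>\<^sup>+\<omega>. (if over n b \<omega> then \<integral>\<^sup>+\<omega>'. \<phi> (run K n x b \<omega>) \<omega>' \<partial>noise else 0) \<partial>noise)"
    by (intro SUP_cong refl markov_run \<phi> \<open>1 \<le> b\<close>)
  also have "\<dots> = (\<integral>\<^sup>+\<omega>. \<integral>\<^sup>+\<omega>'. \<phi> (traj K x b \<omega>) \<omega>' \<partial>noise \<partial>noise)"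
    by (rule sym, subst nn_integral_SUP_over[OF _ \<open>1 \<le> b\<close>], measurable) (simp only: eq2)
  finally show ?thesis .
qed

text \<open>The equality is one of laws and not of paths: \<open>kernel_step\<close> enumerates the
  two state spaces separately, so \<open>f\<close> need not commute with it. It suffices that the
  law of the \<open>f\<close>-image of the next state depends on \<open>x\<close> only through
  \<open>f x\<close>, used after integrating out the variable that selects this state.\<close>

lemma lump_run:
  fixes f :: "'a::countable \<Rightarrow> 'b::countable" and g :: "'b \<Rightarrow> ennreal"
  assumes f: "\<And>x. map_pmf f (K x) = K' (f x)"
  shows "(\<integral>\<^sup>+\<omega>. (if over n b \<omega> then g (f (run K n x b \<omega>)) else 0) \<partial>noise) =
    (\<integral>\<^sup>+\<omega>. (if over n b \<omega> then g (run K' n (f x) b \<omega>) else 0) \<partial>noise)"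
proof (induction n arbitrary: x b)
  case (Suc n)
  let ?J = "\<lambda>y c. (\<integral>\<^sup>+\<omega>. (if over n c \<omega> then g (run K' n y c \<omega>) else 0) \<partial>noise)"
  have *: "(\<integral>\<^sup>+v. ?J (f (kernel_step K x v)) c \<partial>unif01) = (\<integral>\<^sup>+v. ?J (kernel_step K' (f x) v) c \<partial>unif01)" for c
    using nn_integral_kernel_step[of "\<lambda>x. ?J (f x) c" K x] nn_integral_kernel_step[of "\<lambda>y. ?J y c" K' "f x"]
    by (simp flip: f)
  have "(\<integral>\<^sup>+\<omega>. (if over (Suc n) b \<omega> then g (f (run K (Suc n) x b \<omega>)) else 0) \<partial>noise) =
    (\<integral>\<^sup>+u. (\<integral>\<^sup>+v. (if b * u < 1 then g (f x) else
       \<integral>\<^sup>+\<omega>. (if over n (b * u) \<omega> then g (f (run K n (kernel_step K x v) (b * u) \<omega>)) else 0) \<partial>noise) \<partial>unif01) \<partial>unif01)"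
    by (subst nn_integral_noise2, measurable) (auto intro!: nn_integral_cong simp: noise.emeasure_space_1[simplified])
  also have "\<dots> = (\<integral>\<^sup>+u. (if b * u < 1 then g (f x) else
       \<integral>\<^sup>+v. ?J (f (kernel_step K x v)) (b * u) \<partial>unif01) \<partial>unif01)"
    by (auto intro!: nn_integral_cong simp: Suc.IH unif01.emeasure_space_1[simplified])
  also have "\<dots> = (\<integral>\<^sup>+u. (\<integral>\<^sup>+v. (if b * u < 1 then g (f x) else
       ?J (kernel_step K' (f x) v) (b * u)) \<partial>unif01) \<partial>unif01)"
    unfolding * by (auto intro!: nn_integral_cong simp: unif01.emeasure_space_1[simplified])
  also have "\<dots> = (\<integral>\<^sup>+\<omega>. (if over (Suc n) b \<omega> then g (run K' (Suc n) (f x) b \<omega>) else 0) \<partial>noise)"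
    by (subst nn_integral_noise2, measurable) (auto intro!: nn_integral_cong simp: noise.emeasure_space_1[simplified])
  finally show ?case .
qed simp

lemma lump_traj:
  fixes f :: "'a::countable \<Rightarrow> 'b::countable" and g :: "'b \<Rightarrow> ennreal"
  assumes f: "\<And>x. map_pmf f (K x) = K' (f x)" and "1 \<le> b"
  shows "(\<integral>\<^sup>+\<omega>. g (f (traj K x b \<omega>)) \<partial>noise) = (\<integral>\<^sup>+\<omega>. g (traj K' (f x) b \<omega>) \<partial>noise)"
proof -
  have eq1: "(if over n b \<omega> then g (f (traj K x b \<omega>)) else 0) =
      (if over n b \<omega> then g (f (run K n x b \<omega>)) else 0)" for n \<omega>
    by (simp add: traj_eq_run)
  have eq2: "(if over n b \<omega> then g (traj K' (f x) b \<omega>) else 0) =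
      (if over n b \<omega> then g (run K' n (f x) b \<omega>) else 0)" for n \<omega>
    by (simp add: traj_eq_run)
  have "(\<integral>\<^sup>+\<omega>. g (f (traj K x b \<omega>)) \<partial>noise) =
      (SUP n. \<integral>\<^sup>+\<omega>. (if over n b \<omega> then g (f (run K n x b \<omega>)) else 0) \<partial>noise)"
    by (subst nn_integral_SUP_over[OF _ \<open>1 \<le> b\<close>], measurable) (simp only: eq1)
  also have "\<dots> = (SUP n. \<integral>\<^sup>+\<omega>. (if over n b \<omega> then g (run K' n (f x) b \<omega>) else 0) \<partial>noise)"
    by (intro SUP_cong refl lump_run f)
  also have "\<dots> = (\<integral>\<^sup>+\<omega>. g (traj K' (f x) b \<omega>) \<partial>noise)"
    by (rule sym, subst nn_integral_SUP_over[OF _ \<open>1 \<le> b\<close>], measurable) (simp only: eq2)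
  finally show ?thesis .
qed

section \<open>Transition semigroup and finite-dimensional laws\<close>

definition traj_law :: "('a::countable \<Rightarrow> 'a pmf) \<Rightarrow> real \<Rightarrow> 'a \<Rightarrow> 'a pmf" where
  "traj_law K b x = pmf_law noise (traj K x b)"

lemma measure_traj_law: "measure_pmf (traj_law K b x) = distr noise (count_space UNIV) (traj K x b)"
  unfolding traj_law_def by (rule measure_pmf_law[OF prob_space_noise traj_measurable])

lemma nn_integral_traj_law: "(\<integral>\<^sup>+y. g y \<partial>measure_pmf (traj_law K b x)) = (\<integral>\<^sup>+\<omega>. g (traj K x b \<omega>) \<partial>noise)"
  unfolding measure_traj_law by (rule nn_integral_distr) auto

lemma emeasure_traj_eq:
  assumes f: "\<And>x. map_pmf f (K x) = K' (f x)" and "1 \<le> b"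
  shows "emeasure noise {\<omega>. f (traj K x b \<omega>) = a} = pmf (traj_law K' b (f x)) a"
proof -
  have "{\<omega> \<in> space noise. f (traj K x b \<omega>) = a} \<in> sets noise" by measurable
  then have "emeasure noise {\<omega>. f (traj K x b \<omega>) = a} = (\<integral>\<^sup>+\<omega>. indicator {\<omega>. f (traj K x b \<omega>) = a} \<omega> \<partial>noise)"
    by simp
  also have "\<dots> = (\<integral>\<^sup>+\<omega>. indicator {a} (f (traj K x b \<omega>)) \<partial>noise)"
    by (intro nn_integral_cong) (auto simp: indicator_def)
  also have "\<dots> = (\<integral>\<^sup>+\<omega>. indicator {a} (traj K' (f x) b \<omega>) \<partial>noise)"
    by (rule lump_traj[of f K K', OF assms])
  also have "\<dots> = emeasure (measure_pmf (traj_law K' b (f x))) {a}"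
    by (simp flip: nn_integral_traj_law)
  finally show ?thesis by (simp add: emeasure_pmf_single)
qed

lemma pmf_traj_law:
  assumes "1 \<le> b"
  shows "ennreal (pmf (traj_law K b x) a) = emeasure noise {\<omega>. traj K x b \<omega> = a}"
  using emeasure_traj_eq[of "\<lambda>x. x" K K b x a] assms by simp

text \<open>A single null set serves all \<open>d\<close> up to \<open>c\<close>, because exhausting
  the budget \<open>b * c\<close> exhausts every smaller one.\<close>

lemma AE_traj_flow:
  assumes "1 \<le> b" "1 \<le> c"
  shows "AE \<omega> in noise. \<forall>d\<ge>1. d \<le> c \<longrightarrow> traj K x (b * d) \<omega> = traj K (traj K x b \<omega>) d (future b \<omega>)"
proof -
  have "1 \<le> b * c" using mult_mono[OF assms] assms by simp
  from AE_over[OF this] show ?thesis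
  proof eventually_elim
    case (elim \<omega>)
    then obtain n where n: "over n (b * c) \<omega>" by blast
    show ?case
    proof safe
      fix d :: real assume d: "1 \<le> d" "d \<le> c"
      have "over n (b * d) \<omega>"
        using d assms by (intro over_antimono_budget[OF n]) auto
      then show "traj K x (b * d) \<omega> = traj K (traj K x b \<omega>) d (future b \<omega>)"
        using d assms by (intro traj_flow) auto
    qed
  qed
qed

text \<open>The chain is restarted at the first observation. There only \<open>f y = a 0\<close> is
  known of its state \<open>y\<close>, and the induction hypothesis, which holds for every starting
  state, shows that the remaining probability depends on \<open>y\<close> only through
  \<open>f y\<close>. Hence the projected process is Markov. Differences of times appear as
  quotients of budgets.\<close>

lemma emeasure_traj_fdd:
  fixes K :: "'a::countable \<Rightarrow> 'a pmf" and K' :: "'b::countable \<Rightarrow> 'b pmf"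
  assumes f: "\<And>x. map_pmf f (K x) = K' (f x)" and b: "1 \<le> b 0" "incseq b"
  shows "emeasure noise {\<omega>. \<forall>i\<le>n. f (traj K x (b i) \<omega>) = a i} =
    ennreal (pmf (traj_law K' (b 0) (f x)) (a 0) *
      (\<Prod>i<n. pmf (traj_law K' (b (Suc i) / b i) (a i)) (a (Suc i))))"
  using b
proof (induction n arbitrary: x b a)
  case 0
  then show ?case by (simp add: emeasure_traj_eq[of f K K', OF f])
next
  case (Suc n)
  define c where "c i = b (Suc i) / b 0" for i
  define S where "S y = {\<omega>. \<forall>i\<le>n. f (traj K y (c i) \<omega>) = a (Suc i)}" for y
  define p where "p = pmf (traj_law K' (c 0) (a 0)) (a (Suc 0)) *
    (\<Prod>i<n. pmf (traj_law K' (c (Suc i) / c i) (a (Suc i))) (a (Suc (Suc i))))"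
  have b1: "1 \<le> b i" for i
    using Suc.prems(1) incseqD[OF Suc.prems(2), of 0 i] by simp
  then have b0: "0 < b i" for i by (rule less_le_trans[OF zero_less_one])
  then have nz [simp]: "b i \<noteq> 0" for i by (metis less_irrefl)
  have c: "1 \<le> c 0" "incseq c"
    using b0[of 0] Suc.prems(2) by (auto simp: c_def incseq_def intro!: divide_right_mono)
  have bc: "b (Suc i) = b 0 * c i" for i
    using b0[of 0] by (simp add: c_def)
  have S_sets [measurable]: "S y \<in> sets noise" for y
  proof -
    have "{\<omega> \<in> space noise. \<forall>i\<le>n. f (traj K y (c i) \<omega>) = a (Suc i)} \<in> sets noise" by measurable
    then show ?thesis by (simp add: S_def)
  qed
  have IH: "emeasure noise (S y) = ennreal p" if "f y = a 0" for y
    unfolding S_def p_def using Suc.IH[OF c, of y "\<lambda>i. a (Suc i)"] that by simp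
  \<comment> \<open>The first observation is a condition on the state \<open>y\<close>; all later
    ones are conditions on the noise after it.\<close>
  let ?\<phi> = "\<lambda>y \<omega>. if f y = a 0 then indicator (S y) \<omega> else 0 :: ennreal"
  have "{\<omega> \<in> space noise. \<forall>i\<le>Suc n. f (traj K x (b i) \<omega>) = a i} \<in> sets noise" by measurable
  then have "emeasure noise {\<omega>. \<forall>i\<le>Suc n. f (traj K x (b i) \<omega>) = a i} =
      (\<integral>\<^sup>+\<omega>. indicator {\<omega>. \<forall>i\<le>Suc n. f (traj K x (b i) \<omega>) = a i} \<omega> \<partial>noise)"
    by simp
  also have "\<dots> = (\<integral>\<^sup>+\<omega>. ?\<phi> (traj K x (b 0) \<omega>) (future (b 0) \<omega>) \<partial>noise)"
  proof (rule nn_integral_cong_AE)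
    have "1 \<le> c n" using c incseqD[OF c(2), of 0 n] by simp
    from AE_traj_flow[OF b1[of 0] this, of K x]
    show "AE \<omega> in noise. indicator {\<omega>. \<forall>i\<le>Suc n. f (traj K x (b i) \<omega>) = a i} \<omega> =
        ?\<phi> (traj K x (b 0) \<omega>) (future (b 0) \<omega>)"
    proof eventually_elim
      case (elim \<omega>)
      have "traj K x (b (Suc i)) \<omega> = traj K (traj K x (b 0) \<omega>) (c i) (future (b 0) \<omega>)" if "i \<le> n" for i
        using elim c(1) incseqD[OF c(2), of 0 i] incseqD[OF c(2) that] by (simp add: bc)
      moreover have "(\<forall>i\<le>Suc n. P i) \<longleftrightarrow> P 0 \<and> (\<forall>i\<le>n. P (Suc i))" for P
        by (metis Suc_le_mono le0 not0_implies_Suc)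
      ultimately show ?case by (auto simp: indicator_def S_def)
    qed
  qed
  also have "\<dots> = (\<integral>\<^sup>+\<omega>. \<integral>\<^sup>+\<omega>'. ?\<phi> (traj K x (b 0) \<omega>) \<omega>' \<partial>noise \<partial>noise)"
    using b1 by (intro markov_traj[where \<phi>="?\<phi>"]) auto
  also have "\<dots> = (\<integral>\<^sup>+\<omega>. ennreal p * indicator {\<omega>. f (traj K x (b 0) \<omega>) = a 0} \<omega> \<partial>noise)"
  proof (rule nn_integral_cong)
    fix \<omega>
    show "(\<integral>\<^sup>+\<omega>'. ?\<phi> (traj K x (b 0) \<omega>) \<omega>' \<partial>noise) =
        ennreal p * indicator {\<omega>. f (traj K x (b 0) \<omega>) = a 0} \<omega>"
      by (cases "f (traj K x (b 0) \<omega>) = a 0") (auto simp: IH)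
  qed
  also have "\<dots> = ennreal p * emeasure noise {\<omega>. f (traj K x (b 0) \<omega>) = a 0}"
  proof (rule nn_integral_cmult_indicator)
    have "{\<omega> \<in> space noise. f (traj K x (b 0) \<omega>) = a 0} \<in> sets noise" by measurable
    then show "{\<omega>. f (traj K x (b 0) \<omega>) = a 0} \<in> sets noise" by simp
  qed
  also have "\<dots> = ennreal (p * pmf (traj_law K' (b 0) (f x)) (a 0))"
    using b1 by (simp add: emeasure_traj_eq[of f K K', OF f] p_def prod_nonneg ennreal_mult)
  also have "p * pmf (traj_law K' (b 0) (f x)) (a 0) = pmf (traj_law K' (b 0) (f x)) (a 0) *
      (\<Prod>i<Suc n. pmf (traj_law K' (b (Suc i) / b i) (a i)) (a (Suc i)))"
    unfolding p_def prod.lessThan_Suc_shift by (simp add: c_def)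
  finally show ?case .
qed

text \<open>The Chapman-Kolmogorov equation in multiplicative time.\<close>

lemma traj_law_mult:
  assumes "1 \<le> b" "1 \<le> c"
  shows "traj_law K (b * c) x = bind_pmf (traj_law K b x) (traj_law K c)"
proof (rule pmf_eqI)
  fix y
  let ?\<phi> = "\<lambda>z \<omega>. indicator {\<omega>. traj K z c \<omega> = y} \<omega> :: ennreal"
  have sets [measurable]: "{\<omega>. traj K z d \<omega> = y} \<in> sets noise" for z d
  proof -
    have "{\<omega> \<in> space noise. traj K z d \<omega> = y} \<in> sets noise" by measurable
    then show ?thesis by simp
  qed
  have "1 \<le> b * c" using mult_mono[OF assms] assms by simp
  then have "ennreal (pmf (traj_law K (b * c) x) y) = (\<integral>\<^sup>+\<omega>. indicator {\<omega>. traj K x (b * c) \<omega> = y} \<omega> \<partial>noise)"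
    by (simp add: pmf_traj_law)
  also have "\<dots> = (\<integral>\<^sup>+\<omega>. ?\<phi> (traj K x b \<omega>) (future b \<omega>) \<partial>noise)"
    by (rule nn_integral_cong_AE, use AE_traj_flow[OF assms, of K x] in eventually_elim)
       (use assms in \<open>auto simp: indicator_def\<close>)
  also have "\<dots> = (\<integral>\<^sup>+\<omega>. \<integral>\<^sup>+\<omega>'. ?\<phi> (traj K x b \<omega>) \<omega>' \<partial>noise \<partial>noise)"
    using assms by (intro markov_traj[where \<phi>="?\<phi>"]) auto
  also have "\<dots> = (\<integral>\<^sup>+\<omega>. ennreal (pmf (traj_law K c (traj K x b \<omega>)) y) \<partial>noise)"
    using assms by (simp add: pmf_traj_law)
  also have "\<dots> = ennreal (pmf (bind_pmf (traj_law K b x) (traj_law K c)) y)"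
    by (simp only: ennreal_pmf_bind nn_integral_traj_law)
  finally show "pmf (traj_law K (b * c) x) y = pmf (bind_pmf (traj_law K b x) (traj_law K c)) y"
    by simp
qed

section \<open>Small times and the generator\<close>

lemma AE_noise: "AE \<omega> in noise. \<forall>n. 0 < \<omega> !! n \<and> \<omega> !! n < 1"
proof -
  have "AE \<omega> in stream_space unif01. stream_all (\<lambda>u. 0 < u \<and> u < 1) \<omega>"
    by (rule unif01.AE_stream_all[OF _ AE_unif01]) measurable
  then show ?thesis
    unfolding noise_def by (rule eventually_mono) (auto simp: stream.pred_set sset_range)
qed

lemma traj_1:
  assumes "shd \<omega> < 1"
  shows "traj K x 1 \<omega> = x"
  using assms by (subst traj_eq_run[of 1]) auto

lemma traj_law_1: "traj_law K 1 x = return_pmf x"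
proof (rule pmf_eqI)
  fix y
  have "ennreal (pmf (traj_law K 1 x) y) = emeasure noise {\<omega>. traj K x 1 \<omega> = y}"
    by (rule pmf_traj_law) simp
  also have "\<dots> = emeasure noise (if x = y then UNIV else {})"
  proof (rule emeasure_eq_AE)
    show "AE \<omega> in noise. \<omega> \<in> {\<omega>. traj K x 1 \<omega> = y} \<longleftrightarrow> \<omega> \<in> (if x = y then UNIV else {})"
      using AE_noise
    proof eventually_elim
      case (elim \<omega>)
      then have "shd \<omega> < 1" by (metis snth.simps(1))
      then show ?case by (simp add: traj_1)
    qed
    have "{\<omega> \<in> space noise. traj K x 1 \<omega> = y} \<in> sets noise" by measurable
    then show "{\<omega>. traj K x 1 \<omega> = y} \<in> sets noise" by simp
    have "space noise \<in> sets noise" by (rule sets.top)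
    then show "(if x = y then UNIV else {}) \<in> sets noise" by simp
  qed
  also have "\<dots> = ennreal (pmf (return_pmf x) y)"
    using noise.emeasure_space_1 by (auto simp: indicator_def)
  finally show "pmf (traj_law K 1 x) y = pmf (return_pmf x) y" by simp
qed

lemma emeasure_unif01_jump:
  assumes "1 \<le> b"
  shows "emeasure unif01 {u. b * u < 1} = ennreal (1 / b)"
    and "emeasure unif01 {u. \<not> b * u < 1} = ennreal (1 - 1 / b)"
proof -
  have "emeasure unif01 {u. b * u < 1} = (\<integral>\<^sup>+u. indicator {u. b * u < 1} u * 1 \<partial>unif01)"
    by simp
  also have "\<dots> = ennreal (1 / b)"
    by (subst nn_integral_unif01_scale[where f="\<lambda>_. 1", OF _ assms])
       (simp_all add: unif01.emeasure_space_1[simplified])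
  finally show *: "emeasure unif01 {u. b * u < 1} = ennreal (1 / b)" .
  have "{u. \<not> b * u < 1} = space unif01 - {u. b * u < 1}" by auto
  also have "emeasure unif01 \<dots> = ennreal (1 - 1 / b)"
    using assms by (subst emeasure_compl)
      (auto simp: * unif01.emeasure_space_1[simplified] ennreal_minus simp flip: ennreal_1)
  finally show "emeasure unif01 {u. \<not> b * u < 1} = ennreal (1 - 1 / b)" .
qed

text \<open>The law at time \<open>ln b\<close> of the chain frozen after its first jump, which
  serves as the first-order approximation of \<open>traj\<close>.\<close>

lemma prob_first_step:
  assumes "1 \<le> b"
  shows "noise.prob {\<omega>. if b * shd \<omega> < 1 then x = y else kernel_step K x (shd (stl \<omega>)) = y} =
    1 / b * of_bool (x = y) + (1 - 1 / b) * pmf (K x) y"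
proof -
  let ?A = "{\<omega>. if b * shd \<omega> < 1 then x = y else kernel_step K x (shd (stl \<omega>)) = y}"
  have "{\<omega> \<in> space noise. if b * shd \<omega> < 1 then x = y else kernel_step K x (shd (stl \<omega>)) = y} \<in> sets noise"
    by measurable
  then have A [measurable]: "?A \<in> sets noise" by simp
  have "emeasure noise ?A = (\<integral>\<^sup>+\<omega>. indicator ?A \<omega> \<partial>noise)"
    by (rule nn_integral_indicator[symmetric, OF A])
  also have "\<dots> = (\<integral>\<^sup>+u. \<integral>\<^sup>+v. \<integral>\<^sup>+\<omega>. indicator ?A (u ## v ## \<omega>) \<partial>noise \<partial>unif01 \<partial>unif01)"
    by (rule nn_integral_noise2) measurable
  also have "\<dots> = (\<integral>\<^sup>+u. \<integral>\<^sup>+v. (if b * u < 1 then indicator {y} x else indicator {y} (kernel_step K x v)) \<partial>unif01 \<partial>unif01)"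
    by (intro nn_integral_cong) (auto simp: indicator_def noise.emeasure_space_1[simplified])
  also have "\<dots> = (\<integral>\<^sup>+u. ennreal (of_bool (x = y)) * indicator {u. b * u < 1} u +
      ennreal (pmf (K x) y) * indicator {u. \<not> b * u < 1} u \<partial>unif01)"
  proof (intro nn_integral_cong)
    fix u
    show "(\<integral>\<^sup>+v. (if b * u < 1 then indicator {y} x else indicator {y} (kernel_step K x v)) \<partial>unif01) =
        ennreal (of_bool (x = y)) * indicator {u. b * u < 1} u + ennreal (pmf (K x) y) * indicator {u. \<not> b * u < 1} u"
      using nn_integral_kernel_step[of "indicator {y}" K x]
      by (cases "b * u < 1") (auto simp: emeasure_pmf_single unif01.emeasure_space_1[simplified])
  qed
  also have "\<dots> = ennreal (of_bool (x = y)) * ennreal (1 / b) + ennreal (pmf (K x) y) * ennreal (1 - 1 / b)"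
    by (subst nn_integral_add) (simp_all add: nn_integral_cmult_indicator emeasure_unif01_jump[OF assms])
  also have "\<dots> = ennreal (1 / b * of_bool (x = y) + (1 - 1 / b) * pmf (K x) y)"
    using assms by (simp add: mult_ac flip: ennreal_mult ennreal_plus)
  finally show ?thesis
    using assms unfolding noise.emeasure_eq_measure by (subst (asm) ennreal_inj) auto
qed

text \<open>Two jumps within time \<open>ln b\<close> force each of the first two holding times to
  be at most \<open>ln b\<close>. This weaker requirement is a product event, which gives the
  square.\<close>

lemma prob_two_jumps_le:
  assumes "1 \<le> b"
  shows "noise.prob {\<omega>. \<not> b * shd \<omega> < 1 \<and> \<not> b * shd (stl (stl \<omega>)) < 1} \<le> (1 - 1 / b)\<^sup>2"
proof -
  let ?A = "{\<omega>. \<not> b * shd \<omega> < 1 \<and> \<not> b * shd (stl (stl \<omega>)) < 1}"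
  have "{\<omega> \<in> space noise. \<not> b * shd \<omega> < 1 \<and> \<not> b * shd (stl (stl \<omega>)) < 1} \<in> sets noise"
    by measurable
  then have A [measurable]: "?A \<in> sets noise" by simp
  have "emeasure noise ?A = (\<integral>\<^sup>+\<omega>. indicator ?A \<omega> \<partial>noise)"
    by (rule nn_integral_indicator[symmetric, OF A])
  also have "\<dots> = (\<integral>\<^sup>+u. \<integral>\<^sup>+v. \<integral>\<^sup>+\<omega>. indicator ?A (u ## v ## \<omega>) \<partial>noise \<partial>unif01 \<partial>unif01)"
    by (rule nn_integral_noise2) measurable
  also have "\<dots> = (\<integral>\<^sup>+u. ennreal (1 - 1 / b) * indicator {u. \<not> b * u < 1} u \<partial>unif01)"
  proof (intro nn_integral_cong)
    fix u
    have "(\<integral>\<^sup>+\<omega>. indicator {\<omega>. \<not> b * shd \<omega> < 1} \<omega> \<partial>noise) =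
        (\<integral>\<^sup>+w. \<integral>\<^sup>+\<omega>. indicator {u. \<not> b * u < 1} w \<partial>noise \<partial>unif01)"
      by (subst nn_integral_noise) (auto simp: indicator_def intro!: nn_integral_cong)
    also have "\<dots> = ennreal (1 - 1 / b)"
      by (simp add: noise.emeasure_space_1[simplified] emeasure_unif01_jump(2)[OF assms])
    finally have "(\<integral>\<^sup>+\<omega>. indicator ?A (u ## v ## \<omega>) \<partial>noise) =
        ennreal (1 - 1 / b) * indicator {u. \<not> b * u < 1} u" for v
      by (cases "b * u < 1") (auto simp: indicator_def)
    then show "(\<integral>\<^sup>+v. \<integral>\<^sup>+\<omega>. indicator ?A (u ## v ## \<omega>) \<partial>noise \<partial>unif01) =
        ennreal (1 - 1 / b) * indicator {u. \<not> b * u < 1} u"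
      by (simp add: unif01.emeasure_space_1[simplified])
  qed
  also have "\<dots> = ennreal ((1 - 1 / b)\<^sup>2)"
    using assms by (simp add: nn_integral_cmult_indicator emeasure_unif01_jump[OF assms] power2_eq_square ennreal_mult)
  finally show ?thesis
    using assms by (simp add: measure_def)
qed

lemma traj_first_step:
  assumes "shd \<omega> < 1" "0 < shd (stl (stl \<omega>))" "0 < b" "b * shd \<omega> < 1 \<or> b * shd (stl (stl \<omega>)) < 1"
  shows "traj K x b \<omega> = (if b * shd \<omega> < 1 then x else kernel_step K x (shd (stl \<omega>)))"
proof (cases "b * shd \<omega> < 1")
  case True
  then show ?thesis by (subst traj_eq_run[of 1]) auto
next
  case False
  have "b * shd \<omega> * shd (stl (stl \<omega>)) = shd \<omega> * (b * shd (stl (stl \<omega>)))" by simp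
  also have "\<dots> < 1 * 1"
    using assms False by (intro mult_strict_mono) auto
  finally have "over 2 b \<omega>" by (simp add: eval_nat_numeral)
  with False \<open>_ < 1 * 1\<close> show ?thesis
    by (subst traj_eq_run[of 2]) (auto simp: eval_nat_numeral)
qed

text \<open>For \<open>b = exp (c * t)\<close> the error is of order \<open>t\<close> squared, hence
  invisible to the derivative at 0.\<close>

lemma traj_law_first_step:
  assumes "1 \<le> b"
  shows "\<bar>pmf (traj_law K b x) y - (1 / b * of_bool (x = y) + (1 - 1 / b) * pmf (K x) y)\<bar> \<le> (1 - 1 / b)\<^sup>2"
proof -
  let ?A = "{\<omega>. traj K x b \<omega> = y}"
  let ?B = "{\<omega>. if b * shd \<omega> < 1 then x = y else kernel_step K x (shd (stl \<omega>)) = y}"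
  let ?C = "{\<omega>. \<not> b * shd \<omega> < 1 \<and> \<not> b * shd (stl (stl \<omega>)) < 1}"
  have "{\<omega> \<in> space noise. traj K x b \<omega> = y} \<in> sets noise"
    "{\<omega> \<in> space noise. if b * shd \<omega> < 1 then x = y else kernel_step K x (shd (stl \<omega>)) = y} \<in> sets noise"
    "{\<omega> \<in> space noise. \<not> b * shd \<omega> < 1 \<and> \<not> b * shd (stl (stl \<omega>)) < 1} \<in> sets noise"
    by measurable
  then have meas [simp]: "?A \<in> sets noise" "?B \<in> sets noise" "?C \<in> sets noise" by simp_all
  have AE: "AE \<omega> in noise. \<omega> \<notin> ?C \<longrightarrow> (\<omega> \<in> ?A \<longleftrightarrow> \<omega> \<in> ?B)"
    using AE_noise
  proof eventually_elim
    case (elim \<omega>)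
    have "shd \<omega> < 1" "0 < shd (stl (stl \<omega>))"
      using elim[rule_format, of 0] elim[rule_format, of 2] by (auto simp: eval_nat_numeral)
    then show ?case
      using traj_first_step[of \<omega> b K x] assms by auto
  qed
  have "noise.prob ?A \<le> noise.prob (?B \<union> ?C)" "noise.prob ?B \<le> noise.prob (?A \<union> ?C)"
    using AE by (intro noise.finite_measure_mono_AE sets.Un meas; force elim: eventually_mono)+
  then have "\<bar>noise.prob ?A - noise.prob ?B\<bar> \<le> noise.prob ?C"
    using measure_Un_le[of ?A noise ?C] measure_Un_le[of ?B noise ?C] by simp
  also have "\<dots> \<le> (1 - 1 / b)\<^sup>2"
    by (rule prob_two_jumps_le[OF assms])
  finally show ?thesis
    using pmf_traj_law[OF assms, of K x y] prob_first_step[OF assms, of x y K]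
    by (simp add: noise.emeasure_eq_measure)
qed

lemma infsum_pmf_Compl: "(\<Sum>\<^sub>\<infinity>y\<in>-{x}. pmf p y) = 1 - pmf p x"
proof -
  have "(\<Sum>\<^sub>\<infinity>y\<in>-{x}. pmf p y) = infsetsum (pmf p) (- {x})"
    by (rule infsetsum_infsum[symmetric]) (rule pmf_abs_summable)
  also have "\<dots> = measure_pmf.prob p (UNIV - {x})"
    by (simp add: measure_pmf_conv_infsetsum Compl_eq_Diff_UNIV)
  also have "\<dots> = 1 - pmf p x"
    using measure_pmf.prob_compl[of "{x}" p] by (simp add: measure_pmf_single)
  finally show ?thesis .
qed

text \<open>The generator of a uniformized chain is \<open>c\<close> times \<open>K\<close> minus
  the identity. \<open>K\<close> may have self-loops; their mass lowers the exit rate to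
  \<open>c * (1 - pmf (K x) x)\<close>.\<close>

lemma q_matrix_uniformized:
  assumes "\<And>x y. x \<noteq> y \<Longrightarrow> r x y = c * pmf (K x) y"
  shows "q_matrix r x y = c * (pmf (K x) y - of_bool (x = y))"
proof -
  have "(\<Sum>\<^sub>\<infinity>z\<in>-{x}. r x z) = (\<Sum>\<^sub>\<infinity>z\<in>-{x}. c * pmf (K x) z)"
    by (intro infsum_cong assms) auto
  also have "\<dots> = c * (1 - pmf (K x) x)"
    by (simp add: infsum_cmult_right' infsum_pmf_Compl)
  finally show ?thesis
    using assms by (auto simp: q_matrix_def algebra_simps)
qed

lemma DERIV_0_of_quadratic:
  fixes h :: "real \<Rightarrow> real"
  assumes "\<And>t. 0 \<le> t \<Longrightarrow> \<bar>h t\<bar> \<le> c * t\<^sup>2"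
  shows "(h has_real_derivative 0) (at 0 within {0..})"
proof -
  have "h 0 = 0" using assms[of 0] by simp
  have "((\<lambda>t. (h t - h 0) / (t - 0)) \<longlongrightarrow> 0) (at 0 within {0..})"
  proof (rule Lim_null_comparison)
    show "\<forall>\<^sub>F t in at 0 within {0..}. norm ((h t - h 0) / (t - 0)) \<le> c * t"
      unfolding eventually_at_filter
    proof (intro always_eventually allI impI)
      fix t :: real assume "t \<noteq> 0" "t \<in> {0..}"
      then show "norm ((h t - h 0) / (t - 0)) \<le> c * t"
        using assms[of t] \<open>h 0 = 0\<close> by (simp add: divide_le_eq power2_eq_square mult_ac)
    qed
    show "((\<lambda>t. c * t) \<longlongrightarrow> 0) (at 0 within {0..})"
      by (rule tendsto_eq_intros refl | simp)+
  qed
  then show ?thesis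
    by (simp add: has_field_derivative_iff)
qed

lemma transition_function_traj_law:
  assumes r: "\<And>x y. x \<noteq> y \<Longrightarrow> r x y = c * pmf (K x) y" and c: "0 < c"
  shows "transition_function r (\<lambda>t. traj_law K (exp (c * t)))"
  unfolding transition_function_def
proof (intro conjI allI impI)
  show "traj_law K (exp (c * 0)) x = return_pmf x" for x
    by (simp add: traj_law_1)
  show "traj_law K (exp (c * (s + t))) x = bind_pmf (traj_law K (exp (c * s)) x) (traj_law K (exp (c * t)))"
    if "0 \<le> s" "0 \<le> t" for s t x
    using c that by (simp add: distrib_left exp_add traj_law_mult)
  fix x y
  \<comment> \<open>The first-step approximation with \<open>1 / b = exp (- (c * t))\<close>; its
    derivative at 0 is the entry of the Q-matrix.\<close>
  define g where "g t = exp (- (c * t)) * of_bool (x = y) + (1 - exp (- (c * t))) * pmf (K x) y" for t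
  let ?p = "\<lambda>t. pmf (traj_law K (exp (c * t)) x) y"
  have "((\<lambda>t. ?p t - g t) has_real_derivative 0) (at 0 within {0..})"
  proof (rule DERIV_0_of_quadratic)
    fix t :: real assume "0 \<le> t"
    then have "\<bar>?p t - g t\<bar> \<le> (1 - exp (- (c * t)))\<^sup>2"
      using traj_law_first_step[of "exp (c * t)" K x y] c
      by (simp add: g_def exp_minus inverse_eq_divide)
    also have "\<dots> \<le> (c * t)\<^sup>2"
      using exp_ge_add_one_self[of "- (c * t)"] c \<open>0 \<le> t\<close> by (intro power_mono) auto
    finally show "\<bar>?p t - g t\<bar> \<le> c\<^sup>2 * t\<^sup>2"
      by (simp add: power_mult_distrib)
  qed
  moreover have "(g has_real_derivative q_matrix r x y) (at 0 within {0..})"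
  proof -
    have "q_matrix r x y = c * (pmf (K x) y - of_bool (x = y))"
      by (rule q_matrix_uniformized) (rule r)
    then show ?thesis
      unfolding g_def by (auto intro!: derivative_eq_intros simp: algebra_simps)
  qed
  ultimately have "((\<lambda>t. ?p t - g t + g t) has_real_derivative 0 + q_matrix r x y) (at 0 within {0..})"
    by (rule DERIV_add)
  then show "(?p has_real_derivative q_matrix r x y) (at 0 within {0..})"
    by simp
qed

section \<open>Path regularity\<close>

lemma run_right_const:
  assumes "over n c \<omega>" "0 < b" "b < c"
  shows "\<forall>\<^sub>F s in at_right b. run K n x s \<omega> = run K n x b \<omega>"
  using assms
proof (induction n arbitrary: x b c \<omega>)
  case (Suc n)
  show ?case
  proof (cases "b * shd \<omega> < 1")
    case True
    have "((\<lambda>s. s * shd \<omega>) \<longlongrightarrow> b * shd \<omega>) (at_right b)"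
      by (intro tendsto_intros)
    \<comment> \<open>The test is strict and thus stable under a small increase of the budget. A
      ring at equality already counts as a jump, which makes the paths right continuous.\<close>
    then have "\<forall>\<^sub>F s in at_right b. s * shd \<omega> < 1"
      using True by (rule order_tendstoD)
    then show ?thesis
      by eventually_elim (use True in simp)
  next
    case False
    then have u: "0 < shd \<omega>"
      using Suc.prems by (smt (verit) mult_nonneg_nonpos)
    then have "b * shd \<omega> < c * shd \<omega>" using Suc.prems by simp
    moreover have "over n (c * shd \<omega>) (stl (stl \<omega>))"
      using Suc.prems False calculation by simp
    ultimately obtain d where d: "b * shd \<omega> < d"
      "\<And>s. b * shd \<omega> < s \<Longrightarrow> s < d \<Longrightarrow>
        run K n (kernel_step K x (shd (stl \<omega>))) s (stl (stl \<omega>)) =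
        run K n (kernel_step K x (shd (stl \<omega>))) (b * shd \<omega>) (stl (stl \<omega>))"
      using Suc.IH[of "c * shd \<omega>" "stl (stl \<omega>)" "b * shd \<omega>"] Suc.prems u
      unfolding eventually_at_right_field by (metis mult_pos_pos)
    show ?thesis
      unfolding eventually_at_right_field
    proof (intro exI[of _ "d / shd \<omega>"] conjI allI impI)
      show "b < d / shd \<omega>" using d(1) u by (simp add: less_divide_eq)
      fix s assume s: "b < s" "s < d / shd \<omega>"
      then have "b * shd \<omega> < s * shd \<omega>" "s * shd \<omega> < d"
        using u by (simp_all add: less_divide_eq)
      then show "run K (Suc n) x s \<omega> = run K (Suc n) x b \<omega>"
        using d(2) False by simp
    qed
  qed
qed simp

lemma run_left_const:
  assumes "over n c \<omega>" "0 < b" "b \<le> c"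
  shows "\<exists>y. \<forall>\<^sub>F s in at_left b. run K n x s \<omega> = y"
  using assms
proof (induction n arbitrary: x b c \<omega>)
  case (Suc n)
  show ?case
  \<comment> \<open>Equality belongs to the first case: the jump then happens at \<open>b\<close>
    itself, and the left limit is the state before it.\<close>
  proof (cases "b * shd \<omega> \<le> 1")
    case True
    have "run K (Suc n) x s \<omega> = x" if "0 < s" "s < b" for s
    proof -
      have "s * shd \<omega> < 1"
      proof (cases "0 < shd \<omega>")
        case True
        then have "s * shd \<omega> < b * shd \<omega>" using that by simp
        then show ?thesis using \<open>b * shd \<omega> \<le> 1\<close> by simp
      next
        case False
        then have "s * shd \<omega> \<le> 0" using that by (simp add: mult_nonneg_nonpos)
        then show ?thesis by simp
      qed
      then show ?thesis by simp
    qed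
    then show ?thesis
      unfolding eventually_at_left_field using Suc.prems by blast
  next
    case False
    then have u: "0 < shd \<omega>"
      using Suc.prems by (smt (verit) mult_nonneg_nonpos)
    then have "b * shd \<omega> \<le> c * shd \<omega>" using Suc.prems by simp
    moreover have "over n (c * shd \<omega>) (stl (stl \<omega>))"
      using Suc.prems False calculation by simp
    ultimately obtain y d where d: "d < b * shd \<omega>"
      "\<And>s. d < s \<Longrightarrow> s < b * shd \<omega> \<Longrightarrow>
        run K n (kernel_step K x (shd (stl \<omega>))) s (stl (stl \<omega>)) = y"
      using Suc.IH[of "c * shd \<omega>" "stl (stl \<omega>)" "b * shd \<omega>"] Suc.prems u
      unfolding eventually_at_left_field by (metis mult_pos_pos)
    \<comment> \<open>The 1 in the maximum ensures that the first jump has happened by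
      \<open>s\<close>; \<open>d\<close> puts the remaining budget into the range where the later
      path is constant.\<close>
    have "run K (Suc n) x s \<omega> = y" if "max d 1 / shd \<omega> < s" "s < b" for s
    proof -
      have "max d 1 < s * shd \<omega>" "s * shd \<omega> < b * shd \<omega>"
        using that u by (simp_all add: divide_less_eq)
      then show ?thesis using d(2) by simp
    qed
    moreover have "max d 1 / shd \<omega> < b"
      using d(1) False u by (simp add: divide_less_eq)
    ultimately show ?thesis
      unfolding eventually_at_left_field by blast
  qed
qed simp

text \<open>By monotonicity in the budget, countably many integer budgets control all positive
  ones.\<close>

lemma AE_over_all: "AE \<omega> in noise. \<forall>c. \<exists>n. over n c \<omega>"
proof -
  have "AE \<omega> in noise. \<forall>m::nat. \<exists>n. over n (real (Suc m)) \<omega>"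
    unfolding AE_all_countable by (intro allI AE_over) simp
  then show ?thesis
    using AE_noise
  proof eventually_elim
    case (elim \<omega>)
    have u: "0 < shd \<omega>" using spec[OF elim(2), of 0] by simp
    have "\<exists>n. over n c \<omega>" for c
    proof (cases "0 < c")
      case True
      obtain m :: nat where m: "c < m" using reals_Archimedean2 by blast
      obtain n where n: "over n (real (Suc m)) \<omega>" using elim(1) by blast
      have "over n c \<omega>"
        by (rule over_antimono_budget[OF n True]) (use m in simp)
      then show ?thesis ..
    next
      case False
      then have "c * shd \<omega> \<le> 0" using u by (simp add: mult_nonpos_nonneg)
      then have "over 1 c \<omega>" by simp
      then show ?thesis ..
    qed
    then show ?case ..
  qed
qed

lemma cadlag_step_traj:
  assumes over: "\<And>c. \<exists>n. over n c \<omega>" and l: "0 < l"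
  shows "cadlag_step (\<lambda>t. f (traj K x (exp (l * t)) \<omega>))"
proof -
  have traj: "\<forall>\<^sub>F s in at_right b. traj K x s \<omega> = traj K x b \<omega>"
    "\<exists>y. \<forall>\<^sub>F s in at_left b. traj K x s \<omega> = y" if b: "0 < b" for b
  proof -
    \<comment> \<open>A budget beyond \<open>b\<close> provides one amount of fuel valid in a whole
      neighborhood of \<open>b\<close>, so \<open>traj\<close> is there a single
      \<open>run\<close>.\<close>
    obtain n where n: "over n (b + 1) \<omega>" using over by blast
    have eq: "traj K x s \<omega> = run K n x s \<omega>" if "0 < s" "s < b + 1" for s
      by (rule traj_eq_run[OF over_antimono_budget[OF n]]) (use that in auto)
    have "\<forall>\<^sub>F s in at_right b. s \<in> {b<..<b + 1}"
      by (rule eventually_at_right_real) simp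
    moreover have "\<forall>\<^sub>F s in at_right b. run K n x s \<omega> = run K n x b \<omega>"
      by (rule run_right_const[OF n b]) simp
    ultimately show "\<forall>\<^sub>F s in at_right b. traj K x s \<omega> = traj K x b \<omega>"
    proof eventually_elim
      case (elim s)
      then show ?case using b eq[of b] eq[of s] by simp
    qed
    obtain y where "\<forall>\<^sub>F s in at_left b. run K n x s \<omega> = y"
      using run_left_const[OF n b, of K x] by auto
    moreover have "\<forall>\<^sub>F s in at_left b. s \<in> {0<..<b}"
      using b by (rule eventually_at_left_real)
    ultimately have "\<forall>\<^sub>F s in at_left b. traj K x s \<omega> = y"
    proof eventually_elim
      case (elim s)
      then show ?case using eq[of s] by simp
    qed
    then show "\<exists>y. \<forall>\<^sub>F s in at_left b. traj K x s \<omega> = y" by blast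
  qed
  have lim: "((\<lambda>s. exp (l * s)) \<longlongrightarrow> exp (l * t)) (at t within S)" for t S
    by (intro tendsto_intros)
  have right: "filterlim (\<lambda>s. exp (l * s)) (at_right (exp (l * t))) (at_right t)" for t
    unfolding filterlim_at using lim eventually_at_right_less[of t] l
    by (auto elim!: eventually_mono)
  have left: "filterlim (\<lambda>s. exp (l * s)) (at_left (exp (l * t))) (at_left t)" for t
    unfolding filterlim_at using lim eventually_at_left_real[of "t - 1" t] l
    by (auto elim!: eventually_mono)
  show ?thesis
    unfolding cadlag_step_def
  proof (intro conjI allI impI)
    fix t :: real
    show "\<forall>\<^sub>F s in at_right t. f (traj K x (exp (l * s)) \<omega>) = f (traj K x (exp (l * t)) \<omega>)"
      using eventually_compose_filterlim[OF traj(1) right] by (rule eventually_mono) auto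
    obtain y where "\<forall>\<^sub>F s in at_left (exp (l * t)). traj K x s \<omega> = y"
      using traj(2)[of "exp (l * t)"] by auto
    from eventually_compose_filterlim[OF this left]
    show "\<exists>y. \<forall>\<^sub>F s in at_left t. f (traj K x (exp (l * s)) \<omega>) = y"
      by (auto elim!: eventually_mono intro!: exI[of _ "f y"])
  qed
qed

theorem ctmc_traj:
  fixes K :: "'a::countable \<Rightarrow> 'a pmf" and K' :: "'b::countable \<Rightarrow> 'b pmf"
  assumes f: "\<And>x. map_pmf f (K x) = K' (f x)"
    and r: "\<And>x y. x \<noteq> y \<Longrightarrow> r x y = l * pmf (K' x) y" and l: "0 < l"
  shows "ctmc noise (\<lambda>t \<omega>. f (traj K x (exp (l * t)) \<omega>)) r (f x)"
  unfolding ctmc_def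
proof (intro conjI allI impI exI[of _ "\<lambda>t. traj_law K' (exp (l * t))"])
  show "prob_space noise" by (rule prob_space_noise)
  show "(\<lambda>\<omega>. f (traj K x (exp (l * t)) \<omega>)) \<in> noise \<rightarrow>\<^sub>M count_space UNIV" for t
    by measurable
  show "AE \<omega> in noise. f (traj K x (exp (l * 0)) \<omega>) = f x"
    using AE_noise
  proof eventually_elim
    case (elim \<omega>)
    then show ?case using elim[rule_format, of 0] by (simp add: traj_1)
  qed
  show "AE \<omega> in noise. cadlag_step (\<lambda>t. f (traj K x (exp (l * t)) \<omega>))"
    using AE_over_all by eventually_elim (intro cadlag_step_traj l, auto)
  show "transition_function r (\<lambda>t. traj_law K' (exp (l * t)))"
    using r l by (rule transition_function_traj_law)
  fix n :: nat and t :: "nat \<Rightarrow> real" and a :: "nat \<Rightarrow> 'b"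
  assume t: "0 \<le> t 0 \<and> (\<forall>i\<le>n. t i \<le> t (Suc i))"
  \<comment> \<open>Only the times up to index \<open>Suc n\<close> are known to be ordered;
    clipping the index makes the whole sequence monotone.\<close>
  define b where "b i = exp (l * t (min i (Suc n)))" for i
  have "incseq (\<lambda>i. t (min i (Suc n)))"
  proof (rule incseq_SucI)
    fix i
    show "t (min i (Suc n)) \<le> t (min (Suc i) (Suc n))"
      using t by (cases "i \<le> n") (auto simp: min_def le_Suc_eq)
  qed
  then have b: "1 \<le> b 0" "incseq b"
    using t l by (auto simp: b_def incseq_def)
  have fdd: "noise.prob {\<omega> \<in> space noise. \<forall>i\<le>m. f (traj K x (exp (l * t i)) \<omega>) = a i} =
      pmf (traj_law K' (b 0) (f x)) (a 0) *
      (\<Prod>i<m. pmf (traj_law K' (b (Suc i) / b i) (a i)) (a (Suc i)))" if "m \<le> Suc n" for m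
  proof -
    have "{\<omega> \<in> space noise. \<forall>i\<le>m. f (traj K x (exp (l * t i)) \<omega>) = a i} =
        {\<omega>. \<forall>i\<le>m. f (traj K x (b i) \<omega>) = a i}"
      using that by (auto simp: b_def min_def)
    then show ?thesis
      by (simp add: measure_def emeasure_traj_fdd[of f K K', OF f b] prod_nonneg)
  qed
  have "b (Suc n) / b n = exp (l * (t (Suc n) - t n))"
    by (simp add: b_def exp_diff right_diff_distrib)
  then show "noise.prob {\<omega> \<in> space noise. \<forall>i\<le>Suc n. f (traj K x (exp (l * t i)) \<omega>) = a i} =
      noise.prob {\<omega> \<in> space noise. \<forall>i\<le>n. f (traj K x (exp (l * t i)) \<omega>) = a i} *
      pmf (traj_law K' (exp (l * (t (Suc n) - t n))) (a n)) (a (Suc n))"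
    using fdd[of "Suc n"] fdd[of n] by simp
qed

text \<open>Transports a chain along a measure-preserving map, here from streams to the sample space
  \<open>nat \<Rightarrow> real\<close> demanded by \<open>st_le\<close>.\<close>

lemma ctmc_compose:
  assumes X: "ctmc (distr M N h) X r x" and M: "prob_space M" and h [measurable]: "h \<in> M \<rightarrow>\<^sub>M N"
  shows "ctmc M (\<lambda>t \<omega>. X t (h \<omega>)) r x"
proof -
  note X' = X[unfolded ctmc_def]
  have meas [measurable]: "X t \<in> N \<rightarrow>\<^sub>M count_space UNIV" if "0 \<le> t" for t
    using X' that by simp
  obtain P where P: "transition_function r P"
    "\<And>n t a. 0 \<le> t 0 \<and> (\<forall>i\<le>n. t i \<le> t (Suc i)) \<Longrightarrow>
       measure (distr M N h) {\<omega> \<in> space (distr M N h). \<forall>i\<le>Suc n. X (t i) \<omega> = a i} =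
       measure (distr M N h) {\<omega> \<in> space (distr M N h). \<forall>i\<le>n. X (t i) \<omega> = a i} *
         pmf (P (t (Suc n) - t n) (a n)) (a (Suc n))"
    using X' by blast
  have eq: "measure (distr M N h) {\<omega> \<in> space (distr M N h). \<forall>i\<le>n. X (t i) \<omega> = a i} =
      measure M {\<omega> \<in> space M. \<forall>i\<le>n. X (t i) (h \<omega>) = a i}" if t: "\<And>i. i \<le> n \<Longrightarrow> 0 \<le> t i" for n :: nat and t a
  proof -
    have "{\<omega> \<in> space N. X (t i) \<omega> = a i} \<in> sets N" if "i \<le> n" for i
      using measurable_sets[OF meas[OF t[OF that]], of "{a i}"] by (simp add: vimage_def Int_def conj_commute)
    then have "{\<omega> \<in> space N. \<forall>i\<in>{..n}. X (t i) \<omega> = a i} \<in> sets N"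
      by (intro sets.sets_Collect_finite_All) auto
    then have "{\<omega> \<in> space N. \<forall>i\<le>n. X (t i) \<omega> = a i} \<in> sets N"
      by (simp only: Ball_def atMost_iff)
    moreover have "h -` {\<omega> \<in> space N. \<forall>i\<le>n. X (t i) \<omega> = a i} \<inter> space M =
        {\<omega> \<in> space M. \<forall>i\<le>n. X (t i) (h \<omega>) = a i}"
      using measurable_space[OF h] by auto
    ultimately show ?thesis
      by (simp only: measure_distr[OF h] space_distr)
  qed
  show ?thesis
    unfolding ctmc_def
  proof (intro conjI allI impI exI[of _ P])
    show "prob_space M" by (rule M)
    show "(\<lambda>\<omega>. X t (h \<omega>)) \<in> M \<rightarrow>\<^sub>M count_space UNIV" if "0 \<le> t" for t
      using that by measurable
    show "AE \<omega> in M. X 0 (h \<omega>) = x"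
      using X'[THEN conjunct2, THEN conjunct2, THEN conjunct1] by (rule AE_distrD[OF h])
    show "AE \<omega> in M. cadlag_step (\<lambda>t. X t (h \<omega>))"
      using X'[THEN conjunct2, THEN conjunct2, THEN conjunct2, THEN conjunct1] by (rule AE_distrD[OF h])
    show "transition_function r P" by (rule P)
    fix n :: nat and t :: "nat \<Rightarrow> real" and a
    assume t: "0 \<le> t 0 \<and> (\<forall>i\<le>n. t i \<le> t (Suc i))"
    have t0: "0 \<le> t i" if "i \<le> Suc n" for i
      using that
    proof (induction i)
      case (Suc i)
      then show ?case using t by (meson Suc_le_mono Suc_leD order_trans)
    qed (use t in simp)
    show "measure M {\<omega> \<in> space M. \<forall>i\<le>Suc n. X (t i) (h \<omega>) = a i} =
        measure M {\<omega> \<in> space M. \<forall>i\<le>n. X (t i) (h \<omega>) = a i} *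
        pmf (P (t (Suc n) - t n) (a n)) (a (Suc n))"
      using P(2)[OF t, of a] eq[of "Suc n" t a] eq[of n t a] t0 by simp
  qed
qed

text \<open>Runs with any amount of fuel stay in \<open>S\<close>, so one noise path settles all
  budgets simultaneously, whatever value \<open>jumps\<close> takes. No exceptional set depending on
  the time arises.\<close>

lemma traj_in_rel:
  assumes K: "\<And>x. x \<in> S \<Longrightarrow> set_pmf (K x) \<subseteq> S" and "x \<in> S" and \<omega>: "\<And>n. 0 < \<omega> !! n \<and> \<omega> !! n < 1"
  shows "traj K x b \<omega> \<in> S"
proof -
  have "run K n x b \<omega> \<in> S" for n
    using \<open>x \<in> S\<close> \<omega>
  proof (induction n arbitrary: x b \<omega>)
    case (Suc n)
    have "kernel_step K x (shd (stl \<omega>)) \<in> S"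
      using Suc.prems(2)[of 1] K[OF Suc.prems(1)] kernel_step_in_set_pmf[of "shd (stl \<omega>)" K x] by auto
    moreover have "0 < stl (stl \<omega>) !! m \<and> stl (stl \<omega>) !! m < 1" for m
      using Suc.prems(2)[of "Suc (Suc m)"] by simp
    ultimately show ?case using Suc by simp
  qed simp
  then show ?thesis by (simp add: traj_def)
qed

section \<open>Occupancy tails\<close>

text \<open>Double counting: server \<open>v\<close> is counted once for each level from
  \<open>m\<close> to \<open>y v\<close>. Truncated subtraction gives 0 for servers below
  \<open>m\<close>.\<close>

lemma Qbar_plus_eq: "Qbar_plus y m = (\<Sum>v\<in>UNIV. Suc (y v) - m)"
proof -
  \<comment> \<open>Beyond the longest queue all terms vanish, which makes the sum finite.\<close>
  define B where "B = Max (range y)"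
  have B: "y v \<le> B" for v unfolding B_def by simp
  have Qbar: "Qbar y i = (\<Sum>v\<in>UNIV. of_bool (i \<le> y v))" for i
    unfolding Qbar_def by (simp add: of_bool_def flip: sum.inter_filter)
  have "Qbar_plus y m = (\<Sum>\<^sub>\<infinity>i\<in>{m..B}. Qbar y i)"
    unfolding Qbar_plus_def
  proof (rule infsum_cong_neutral)
    fix i assume "i \<in> {m..} - {m..B}"
    then have "\<not> i \<le> y v" for v using B[of v] by auto
    then show "Qbar y i = 0" by (simp add: Qbar)
  qed auto
  also have "\<dots> = (\<Sum>v\<in>UNIV. \<Sum>i\<in>{m..B}. of_bool (i \<le> y v))"
    unfolding Qbar by (subst sum.swap) simp
  also have "\<dots> = (\<Sum>v\<in>UNIV. Suc (y v) - m)"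
  proof (rule sum.cong[OF refl])
    fix v
    have "(\<Sum>i\<in>{m..B}. of_bool (i \<le> y v)) = card {i \<in> {m..B}. i \<le> y v}"
      by (simp add: of_bool_def flip: sum.inter_filter)
    also have "{i \<in> {m..B}. i \<le> y v} = {m..y v}"
      using B[of v] by auto
    finally show "(\<Sum>i\<in>{m..B}. of_bool (i \<le> y v)) = Suc (y v) - m" by simp
  qed
  finally show ?thesis .
qed

lemma Qbar_plus_Suc: "Qbar_plus y m = Qbar y m + Qbar_plus y (Suc m)"
proof -
  have "Qbar y m = (\<Sum>v\<in>UNIV. of_bool (m \<le> y v))"
    unfolding Qbar_def by (simp add: of_bool_def flip: sum.inter_filter)
  then show ?thesis
    unfolding Qbar_plus_eq by (simp only: sum.distrib[symmetric]) (auto intro!: sum.cong)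
qed

lemma Qbar_plus_upd: "Qbar_plus (y(w := n)) m + (Suc (y w) - m) = Qbar_plus y m + (Suc n - m)"
  unfolding Qbar_plus_eq by (simp add: sum.remove[of _ w])

lemma Qbar_plus_incr: "Qbar_plus (y(w := y w + 1)) m = Qbar_plus y m + of_bool (m \<le> y w + 1)"
  using Qbar_plus_upd[of y w "y w + 1" m] by (auto simp: Suc_diff_le)

text \<open>For \<open>1 \<le> m\<close> a departure from an empty server changes neither side; at
  \<open>m = 0\<close> the indicator would wrongly count it.\<close>

lemma Qbar_plus_decr:
  "1 \<le> m \<Longrightarrow> Qbar_plus (y(w := y w - 1)) m + of_bool (m \<le> y w) = Qbar_plus y m"
  using Qbar_plus_upd[of y w "y w - 1" m] by (auto simp: Suc_diff_le)

section \<open>Domination and tight levels\<close>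

definition dominated :: "('v::finite \<Rightarrow> nat) \<Rightarrow> ('s::finite \<Rightarrow> nat) \<Rightarrow> bool" where
  "dominated x y \<longleftrightarrow> (\<forall>m\<ge>1. Qbar_plus x m \<le> Qbar_plus y m)"

definition tight :: "('v::finite \<Rightarrow> nat) \<Rightarrow> ('s::finite \<Rightarrow> nat) \<Rightarrow> nat set" where
  "tight x y = {m. 1 \<le> m \<and> Qbar_plus x m = Qbar_plus y m}"

lemma dominated_incr_right:
  assumes "dominated x y"
  shows "dominated x (y(s := y s + 1))"
  using assms unfolding dominated_def Qbar_plus_incr by (auto intro: trans_le_add1)

lemma dominated_incr:
  assumes "dominated x y" and "\<And>m. m \<in> tight x y \<Longrightarrow> m \<le> x v + 1 \<Longrightarrow> m \<le> y s + 1"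
  shows "dominated (x(v := x v + 1)) (y(s := y s + 1))"
  unfolding dominated_def Qbar_plus_incr
proof safe
  fix m :: nat assume m: "1 \<le> m"
  then have "Qbar_plus x m \<le> Qbar_plus y m" using assms(1) by (simp add: dominated_def)
  then show "Qbar_plus x m + of_bool (m \<le> x v + 1) \<le> Qbar_plus y m + of_bool (m \<le> y s + 1)"
    using assms(2)[of m] m by (cases "Qbar_plus x m = Qbar_plus y m") (auto simp: tight_def)
qed

lemma dominated_decr:
  assumes "dominated x y" and "\<And>m. m \<in> tight x y \<Longrightarrow> m \<le> y s \<Longrightarrow> m \<le> x v"
  shows "dominated (x(v := x v - 1)) (y(s := y s - 1))"
  unfolding dominated_def
proof safe
  fix m :: nat assume m: "1 \<le> m"
  then have "Qbar_plus x m \<le> Qbar_plus y m" using assms(1) by (simp add: dominated_def)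
  then show "Qbar_plus (x(v := x v - 1)) m \<le> Qbar_plus (y(s := y s - 1)) m"
    using assms(2)[of m] m Qbar_plus_decr[OF m, of x v] Qbar_plus_decr[OF m, of y s]
    by (cases "Qbar_plus x m = Qbar_plus y m") (auto simp: tight_def of_bool_def split: if_splits)
qed

lemma tight_Suc_Qbar_le:
  assumes "dominated x y" "Suc l \<in> tight x y" "1 \<le> l"
  shows "Qbar x l \<le> Qbar y l"
  using assms Qbar_plus_Suc[of x l] Qbar_plus_Suc[of y l] by (auto simp: dominated_def tight_def)

lemma tight_Qbar_ge:
  assumes "dominated x y" "m \<in> tight x y"
  shows "Qbar y m \<le> Qbar x m"
proof -
  have "Qbar_plus x (Suc m) \<le> Qbar_plus y (Suc m)"
    using assms(1) by (simp add: dominated_def)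
  then show ?thesis
    using assms(2) Qbar_plus_Suc[of x m] Qbar_plus_Suc[of y m] by (simp add: tight_def)
qed

section \<open>Coupling rules, binomial telescoping and closed neighborhoods\<close>

lemma rel_pmf_pairI:
  assumes "\<And>a b. a \<in> set_pmf p \<Longrightarrow> b \<in> set_pmf q \<Longrightarrow> R a b"
  shows "rel_pmf R p q"
  using assms by (intro rel_pmf.intros[where pq="pair_pmf p q"]) (auto simp: map_fst_pair_pmf map_snd_pair_pmf)

lemma rel_pmf_bind_strongI:
  assumes "rel_pmf R p q"
    and "\<And>a b. a \<in> set_pmf p \<Longrightarrow> b \<in> set_pmf q \<Longrightarrow> R a b \<Longrightarrow> rel_pmf P (f a) (g b)"
  shows "rel_pmf P (bind_pmf p f) (bind_pmf q g)"
proof (rule rel_pmf_bindI)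
  show "rel_pmf (\<lambda>a b. a \<in> set_pmf p \<and> b \<in> set_pmf q \<and> R a b) p q"
    using assms(1) by (rule pmf.rel_mono_strong) auto
qed (use assms(2) in auto)

text \<open>Pascal's rule iterated. With \<open>n = d + 1\<close> and \<open>n + M = N\<close>, the
  sum is the left-hand side of the binomial condition.\<close>

lemma choose_telescope:
  assumes "1 \<le> k"
  shows "(n + M) choose k = (n choose k) + (\<Sum>i=1..M. (n + M - i) choose (k - 1))"
proof (induction M)
  case (Suc M)
  obtain j where k: "k = Suc j" using assms by (cases k) auto
  have "(\<Sum>i=1..Suc M. (n + Suc M - i) choose j) = (n + M choose j) + (\<Sum>i=1..M. (n + M - i) choose j)"
    by (subst sum.atLeast_Suc_atMost) (simp_all add: sum.shift_bounds_cl_Suc_ivl del: sum.cl_ivl_Suc)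
  then show ?case using Suc by (simp add: k del: sum.cl_ivl_Suc)
qed simp

lemma card_selection:
  assumes "simple_regular_graph d E"
  shows "card (selection E v) = d + 1"
proof -
  have "v \<notin> {w. E v w}" using assms by (auto simp: simple_regular_graph_def irreflp_def)
  then show ?thesis using assms by (simp add: selection_def simple_regular_graph_def)
qed

lemma selection_sym:
  assumes "simple_regular_graph d E"
  shows "v \<in> selection E u \<longleftrightarrow> u \<in> selection E v"
  using assms by (auto simp: selection_def simple_regular_graph_def dest: sympD)

text \<open>If some \<open>u\<close> lies outside \<open>X\<close>, then none of the \<open>d + 1\<close> vertices \<open>v\<close> in the closed
  neighborhood of \<open>u\<close> has its own closed neighborhood inside \<open>X\<close>.\<close>

lemma closed_neighborhoods_within_le:
  fixes E :: "'v::finite \<Rightarrow> 'v \<Rightarrow> bool" and X :: "'v set"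
  defines "N \<equiv> CARD('v)"
  assumes E: "simple_regular_graph d E" and k: "1 \<le> k" "k \<le> N"
    and cond: "(\<Sum>i = 1..N - d - 1. real ((N - i) choose (k - 1))) < (real d + 1) / real N * real (N choose k)"
    and X: "card X \<le> q"
  shows "card {v. selection E v \<subseteq> X} / N \<le> real (q choose k) / real (N choose k)"
proof (cases "X = UNIV \<or> card X < d + 1")
  case True
  have pos: "0 < N choose k" using k by simp
  from True show ?thesis
  proof
    assume "X = UNIV"
    then have "N \<le> q" using X by (simp add: N_def)
    then have "N choose k \<le> q choose k" by (rule binomial_right_mono)
    then show ?thesis using \<open>X = UNIV\<close> pos by (simp add: N_def)
  next
    assume "card X < d + 1"
    then have "\<not> selection E v \<subseteq> X" for v
      using card_mono[of X "selection E v"] card_selection[OF E, of v] by auto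
    then show ?thesis by simp
  qed
next
  case False
  then obtain u where u: "u \<notin> X" by auto
  have N: "0 < N" "0 < N choose k" using k by (auto simp: N_def)
  have dN: "d + 1 \<le> N"
    using card_mono[of UNIV "selection E u"] by (simp add: card_selection[OF E] N_def)
  have "{v. selection E v \<subseteq> X} \<subseteq> - selection E u"
    using u by (auto simp: selection_sym[OF E])
  then have "card {v. selection E v \<subseteq> X} \<le> card (- selection E u)"
    by (intro card_mono) auto
  also have "\<dots> = N - (d + 1)"
    by (simp add: Compl_eq_Diff_UNIV card_Diff_subset card_selection[OF E] N_def)
  finally have "real (card {v. selection E v \<subseteq> X}) \<le> real N - (real d + 1)"
    using dN by linarith
  then have "card {v. selection E v \<subseteq> X} / N \<le> 1 - (real d + 1) / N"
    using N by (simp add: divide_simps)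
  also have "\<dots> \<le> real ((d + 1) choose k) / real (N choose k)"
  proof -
    have "N choose k = ((d + 1) choose k) + (\<Sum>i=1..N - d - 1. (N - i) choose (k - 1))"
      using choose_telescope[OF k(1), of "d + 1" "N - d - 1"] dN by simp
    then have "real (N choose k) = real ((d + 1) choose k) + (\<Sum>i=1..N - d - 1. real ((N - i) choose (k - 1)))"
      by (metis of_nat_add of_nat_sum)
    with cond have "real (N choose k) * (1 - (real d + 1) / N) \<le> real ((d + 1) choose k)"
      by (simp add: algebra_simps)
    then show ?thesis using N by (simp add: le_divide_eq mult.commute)
  qed
  \<comment> \<open>Outside the first case \<open>X\<close> has at least \<open>d + 1\<close>
    elements, hence so does the bound \<open>q\<close>.\<close>
  also have "(d + 1) choose k \<le> q choose k"
    using False X by (intro binomial_right_mono) auto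
  then have "real ((d + 1) choose k) / real (N choose k) \<le> real (q choose k) / real (N choose k)"
    by (simp add: divide_right_mono)
  finally show ?thesis .
qed

section \<open>One-step couplings\<close>

text \<open>Every server rings at rate \<open>\<mu>\<^sub>1\<close>. With
  \<open>\<rho> = \<mu>\<^sub>2 / \<mu>\<^sub>1\<close>, thinning brings type II completions down to
  rate \<open>\<mu>\<^sub>2\<close>; a ring at an idle server is lost. Thus both systems have the
  same potential service rate.\<close>

definition aff_serve :: "real \<Rightarrow> 'v aff_state \<Rightarrow> 'v \<Rightarrow> 'v aff_state pmf" where
  "aff_serve \<rho> z v =
     (if 0 < fst (z v) then return_pmf (z(v := (fst (z v) - 1, snd (z v))))
      else if 0 < snd (z v)
        then bind_pmf (bernoulli_pmf \<rho>) (\<lambda>a. return_pmf (if a then z(v := (0, snd (z v) - 1)) else z))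
      else return_pmf z)"

definition aff_kernel ::
  "('v::finite \<Rightarrow> 'v \<Rightarrow> bool) \<Rightarrow> ('v aff_state \<Rightarrow> 'v set \<Rightarrow> 'v pmf) \<Rightarrow>
   real \<Rightarrow> real \<Rightarrow> 'v aff_state \<Rightarrow> 'v aff_state pmf" where
  "aff_kernel E \<tau> p \<rho> z = bind_pmf (bernoulli_pmf p) (\<lambda>arrival.
     if arrival
       then bind_pmf (pmf_of_set UNIV) (\<lambda>v. map_pmf (aff_assign (selection E v) z) (\<tau> z (selection E v)))
       else bind_pmf (pmf_of_set UNIV) (aff_serve \<rho> z))"

text \<open>Truncated subtraction turns a service ring at an empty queue into a self-loop.\<close>

definition jsq_kernel ::
  "nat \<Rightarrow> (('s::finite \<Rightarrow> nat) \<Rightarrow> 's set \<Rightarrow> 's pmf) \<Rightarrow> real \<Rightarrow> ('s \<Rightarrow> nat) \<Rightarrow> ('s \<Rightarrow> nat) pmf" where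
  "jsq_kernel k \<sigma> p y = bind_pmf (bernoulli_pmf p) (\<lambda>arrival.
     if arrival
       then bind_pmf (pmf_of_set {S. card S = k}) (\<lambda>S. map_pmf (\<lambda>w. y(w := y w + 1)) (\<sigma> y S))
       else bind_pmf (pmf_of_set UNIV) (\<lambda>v. return_pmf (y(v := y v - 1))))"

lemma pmf_bernoulli_bind_if:
  assumes "0 \<le> p" "p \<le> 1"
  shows "pmf (bind_pmf (bernoulli_pmf p) (\<lambda>a. if a then P else Q)) x = p * pmf P x + (1 - p) * pmf Q x"
  using assms by (simp add: pmf_bind mult.commute)

lemma aff_rate_eq:
  fixes z :: "'v::finite aff_state"
  assumes "0 < lam" "0 < \<mu>\<^sub>2" "\<mu>\<^sub>2 < \<mu>\<^sub>1" "z \<noteq> z'"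
  shows "aff_rate E \<tau> lam \<mu>\<^sub>1 \<mu>\<^sub>2 z z' =
    (lam + \<mu>\<^sub>1) * CARD('v) * pmf (aff_kernel E \<tau> (lam / (lam + \<mu>\<^sub>1)) (\<mu>\<^sub>2 / \<mu>\<^sub>1) z) z'"
proof -
  let ?N = "real CARD('v)" and ?p = "lam / (lam + \<mu>\<^sub>1)" and ?c = "(lam + \<mu>\<^sub>1) * CARD('v)"
  let ?A = "\<lambda>v. pmf (map_pmf (aff_assign (selection E v) z) (\<tau> z (selection E v))) z'"
  \<comment> \<open>Rings without effect are self-loops and contribute nothing to a target
    \<open>z' \<noteq> z\<close>.\<close>
  have serve: "pmf (aff_serve (\<mu>\<^sub>2 / \<mu>\<^sub>1) z v) z' * \<mu>\<^sub>1 =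
      (if 0 < fst (z v) then \<mu>\<^sub>1 * of_bool (z' = z(v := (fst (z v) - 1, snd (z v))))
       else if 0 < snd (z v) then \<mu>\<^sub>2 * of_bool (z' = z(v := (0, snd (z v) - 1))) else 0)" for v
    using assms by (auto simp: aff_serve_def pmf_bind indicator_def)
  have p: "0 \<le> ?p" "?p \<le> 1" "?c * ?p = lam * ?N" "?c * (1 - ?p) = \<mu>\<^sub>1 * ?N"
    using assms by (auto simp: field_simps)
  have "?c * pmf (aff_kernel E \<tau> ?p (\<mu>\<^sub>2 / \<mu>\<^sub>1) z) z' =
      ?c * ?p * ((\<Sum>v\<in>UNIV. ?A v) / ?N) + ?c * (1 - ?p) * ((\<Sum>v\<in>UNIV. pmf (aff_serve (\<mu>\<^sub>2 / \<mu>\<^sub>1) z v) z') / ?N)"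
    unfolding aff_kernel_def pmf_bernoulli_bind_if[OF p(1,2)]
    by (simp add: pmf_bind_pmf_of_set distrib_left mult.assoc)
  also have "\<dots> = (\<Sum>v\<in>UNIV. lam * ?A v) + (\<Sum>v\<in>UNIV. pmf (aff_serve (\<mu>\<^sub>2 / \<mu>\<^sub>1) z v) z' * \<mu>\<^sub>1)"
    unfolding p by (simp flip: sum_distrib_left sum_distrib_right)
  finally show ?thesis
    unfolding serve aff_rate_def by simp
qed

lemma jsq_rate_eq:
  fixes y :: "'s::finite \<Rightarrow> nat" and lam \<mu> :: real
  assumes "0 < lam" "0 < \<mu>" "y \<noteq> y'"
  shows "jsq_rate k \<sigma> (lam * CARD('s)) \<mu> y y' =
    (lam + \<mu>) * CARD('s) * pmf (jsq_kernel k \<sigma> (lam / (lam + \<mu>)) y) y'"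
proof -
  let ?N = "real CARD('s)" and ?p = "lam / (lam + \<mu>)" and ?c = "(lam + \<mu>) * CARD('s)"
  let ?A = "pmf (bind_pmf (pmf_of_set {S. card S = k}) (\<lambda>S. map_pmf (\<lambda>w. y(w := y w + 1)) (\<sigma> y S))) y'"
  have serve: "pmf (return_pmf (y(v := y v - 1))) y' * \<mu> =
      (if 0 < y v then \<mu> * of_bool (y' = y(v := y v - 1)) else 0)" for v
    using assms by (auto simp: indicator_def)
  have p: "0 \<le> ?p" "?p \<le> 1" "?c * ?p = lam * ?N" "?c * (1 - ?p) = \<mu> * ?N"
    using assms by (auto simp: field_simps)
  have "?c * pmf (jsq_kernel k \<sigma> ?p y) y' =
      ?c * ?p * ?A + ?c * (1 - ?p) * ((\<Sum>v\<in>UNIV. pmf (return_pmf (y(v := y v - 1))) y') / ?N)"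
    unfolding jsq_kernel_def pmf_bernoulli_bind_if[OF p(1,2)]
    by (simp add: pmf_bind_pmf_of_set distrib_left mult.assoc del: pmf_return)
  also have "\<dots> = lam * ?N * ?A + (\<Sum>v\<in>UNIV. pmf (return_pmf (y(v := y v - 1))) y' * \<mu>)"
    unfolding p by (simp del: pmf_return flip: sum_distrib_right)
  finally show ?thesis
    unfolding serve jsq_rate_def by simp
qed

text \<open>A type II assignment leaves the type I counts unchanged, and an assignment to an idle server
  raises them only at level 1, where JSQ never falls behind. So only states without idle servers matter.\<close>

definition aff_level :: "('v::finite \<Rightarrow> 'v \<Rightarrow> bool) \<Rightarrow> 'v aff_state \<Rightarrow> 'v \<Rightarrow> nat" where
  "aff_level E z v = (if idle z = {} then Suc (Min ((fst \<circ> z) ` selection E v)) else 1)"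

lemma fst_aff_assign:
  "fst \<circ> aff_assign S z w = (if w \<in> S then (fst \<circ> z)(w := (fst \<circ> z) w + 1) else fst \<circ> z)"
  by (auto simp: aff_assign_def)

text \<open>With an idle server present, a candidate inside the selection is itself idle, since
  otherwise the job goes to an idle server outside; with none, it minimizes the number of type I
  jobs over the selection.\<close>

lemma aff_level_candidates:
  fixes E :: "'v::finite \<Rightarrow> 'v \<Rightarrow> bool"
  assumes "w \<in> aff_candidates z (selection E v)" "w \<in> selection E v"
  shows "fst (z w) + 1 \<le> aff_level E z v"
proof (cases "idle z = {}")
  case True
  then have "fst (z w) \<le> fst (z u)" if "u \<in> selection E v" for u
    using assms(1) that by (auto simp: aff_candidates_def)
  then have "fst (z w) \<le> Min ((fst \<circ> z) ` selection E v)"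
    using assms(2) by (subst Min_ge_iff) auto
  then show ?thesis using True by (simp add: aff_level_def)
next
  case False
  then have "selection E v \<inter> idle z \<noteq> {} \<or> - selection E v \<inter> idle z \<noteq> {}" by auto
  then have "w \<in> idle z"
    using assms by (auto simp: aff_candidates_def split: if_splits)
  then show ?thesis using False by (simp add: aff_level_def idle_def)
qed

lemma rel_arrival:
  fixes E :: "'v::finite \<Rightarrow> 'v \<Rightarrow> bool" and y :: "'s::finite \<Rightarrow> nat"
  defines "N \<equiv> CARD('v)"
  assumes N: "CARD('s) = N" and E: "simple_regular_graph d E" and k: "1 \<le> k" "k \<le> N"
    and cond: "(\<Sum>i = 1..N - d - 1. real ((N - i) choose (k - 1))) < (real d + 1) / real N * real (N choose k)"
    and \<tau>: "aff_tie_rule E \<tau>" and \<sigma>: "jsq_tie_rule k \<sigma>"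
    and dom: "dominated (fst \<circ> z) y"
  shows "rel_pmf (\<lambda>z y. dominated (fst \<circ> z) y)
    (bind_pmf (pmf_of_set UNIV) (\<lambda>v. map_pmf (aff_assign (selection E v) z) (\<tau> z (selection E v))))
    (bind_pmf (pmf_of_set {S. card S = k}) (\<lambda>S. map_pmf (\<lambda>w. y(w := y w + 1)) (\<sigma> y S)))"
proof -
  let ?S = "{S :: 's set. card S = k}"
  have card_S: "card ?S = N choose k"
    using n_subsets[of "UNIV :: 's set" k] by (simp add: N)
  then have "0 < card ?S" using k by simp
  then have S: "?S \<noteq> {}" "finite ?S"
    unfolding card_gt_0_iff by blast+
  have set_S: "set_pmf (pmf_of_set ?S) = ?S" using S by (simp add: set_pmf_of_set)
  \<comment> \<open>The arrival vertex and the JSQ sample are coupled before any tie is broken.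
    Their levels bound what the arrival can raise on one side and what it must raise on the
    other.\<close>
  have "rel_pmf (\<lambda>v S. \<forall>m\<in>tight (fst \<circ> z) y. m \<le> aff_level E z v \<longrightarrow> m \<le> Suc (Min (y ` S)))
      (pmf_of_set UNIV) (pmf_of_set ?S)"
  proof (rule rel_pmf_thresholds)
    fix m assume m: "m \<in> tight (fst \<circ> z) y"
    show "measure_pmf.prob (pmf_of_set UNIV) {v. m \<le> aff_level E z v} \<le>
        measure_pmf.prob (pmf_of_set ?S) {S. m \<le> Suc (Min (y ` S))}"
    proof (cases "m \<le> 1")
      case True
      then have "{S. m \<le> Suc (Min (y ` S))} = UNIV" by auto
      then show ?thesis by simp
    next
      case False
      then obtain l where l: "m = Suc l" "1 \<le> l" by (cases m) auto
      define X where "X = {v. l \<le> (fst \<circ> z) v}"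
      define Y where "Y = {s. l \<le> y s}"
      have "card X \<le> card Y"
        using tight_Suc_Qbar_le[OF dom, of l] m l by (simp add: Qbar_def X_def Y_def)
      \<comment> \<open>If some server is idle, \<open>aff_level\<close> is 1 and the left-hand set
        is empty because \<open>m\<close> is at least 2.\<close>
      have "{v. m \<le> aff_level E z v} \<subseteq> {v. selection E v \<subseteq> X}"
        using l by (auto simp: aff_level_def X_def Min_ge_iff selection_def split: if_splits)
      then have "measure_pmf.prob (pmf_of_set UNIV) {v. m \<le> aff_level E z v} \<le>
          measure_pmf.prob (pmf_of_set UNIV) {v. selection E v \<subseteq> X}"
        by (intro measure_pmf.finite_measure_mono) auto
      also have "\<dots> = card {v. selection E v \<subseteq> X} / N"
        by (simp add: measure_pmf_of_set N_def)
      also have "\<dots> \<le> real (card Y choose k) / real (N choose k)"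
        using closed_neighborhoods_within_le[OF E, of k X "card Y"] k cond \<open>card X \<le> card Y\<close>
        by (simp add: N_def)
      also have "card Y choose k = card (?S \<inter> {S. S \<subseteq> Y})"
        using n_subsets[of Y k] by (simp add: Int_def conj_commute)
      also have "real \<dots> / real (N choose k) = measure_pmf.prob (pmf_of_set ?S) {S. S \<subseteq> Y}"
        using S card_S by (simp add: measure_pmf_of_set)
      also have "\<dots> \<le> measure_pmf.prob (pmf_of_set ?S) {S. m \<le> Suc (Min (y ` S))}"
      proof (rule measure_pmf.finite_measure_mono_AE)
        \<comment> \<open>\<open>1 \<le> k\<close> keeps the sample nonempty, so that its minimum is
          meaningful.\<close>
        have "l \<le> Min (y ` S)" if "card S = k" "S \<subseteq> Y" for S
          using that k(1) by (subst Min_ge_iff) (auto simp: Y_def)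
        then show "AE S in pmf_of_set ?S. S \<in> {S. S \<subseteq> Y} \<longrightarrow> S \<in> {S. m \<le> Suc (Min (y ` S))}"
          by (auto simp: AE_measure_pmf_iff set_S l)
      qed simp
      finally show ?thesis .
    qed
  qed
  then show ?thesis
  proof (rule rel_pmf_bind_strongI)
    fix v S
    assume "S \<in> set_pmf (pmf_of_set ?S)"
      and lv: "\<forall>m\<in>tight (fst \<circ> z) y. m \<le> aff_level E z v \<longrightarrow> m \<le> Suc (Min (y ` S))"
    then have S: "card S = k" by (simp add: set_S)
    show "rel_pmf (\<lambda>z y. dominated (fst \<circ> z) y)
        (map_pmf (aff_assign (selection E v) z) (\<tau> z (selection E v)))
        (map_pmf (\<lambda>w. y(w := y w + 1)) (\<sigma> y S))"
      unfolding pmf.rel_map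
    \<comment> \<open>Given \<open>v\<close> and \<open>S\<close>, every pair of admissible choices
      preserves the order, so the tie-breaking rules can be coupled independently.\<close>
    proof (rule rel_pmf_pairI)
      fix w s assume w: "w \<in> set_pmf (\<tau> z (selection E v))" and s: "s \<in> set_pmf (\<sigma> y S)"
      have "s \<in> S" "\<forall>u\<in>S. y s \<le> y u"
        using s \<sigma> S by (auto simp: jsq_tie_rule_def)
      then have min: "Min (y ` S) \<le> y s" by simp
      have cand: "w \<in> aff_candidates z (selection E v)"
        using w \<tau> by (auto simp: aff_tie_rule_def)
      show "dominated (fst \<circ> aff_assign (selection E v) z w) (y(s := y s + 1))"
      proof (cases "w \<in> selection E v")
        case True
        then have "(fst \<circ> z) w + 1 \<le> aff_level E z v"
          using aff_level_candidates[OF cand] by simp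
        then have "m \<le> y s + 1" if "m \<in> tight (fst \<circ> z) y" "m \<le> (fst \<circ> z) w + 1" for m
          using lv that min by fastforce
        then show ?thesis
          using True dom by (simp only: fst_aff_assign if_True) (rule dominated_incr)
      next
        case False
        then show ?thesis
          using dom by (simp only: fst_aff_assign if_False) (rule dominated_incr_right)
      qed
    qed
  qed
qed

text \<open>Without type I jobs the truncated subtraction leaves 0, which covers type II completions
  and lost rings as well.\<close>

lemma fst_aff_serve:
  assumes "z' \<in> set_pmf (aff_serve \<rho> z v)"
  shows "fst \<circ> z' = (fst \<circ> z)(v := (fst \<circ> z) v - 1)"
  using assms by (auto simp: aff_serve_def fun_eq_iff split: if_splits)

lemma rel_departure:
  fixes z :: "'v::finite aff_state" and y :: "'s::finite \<Rightarrow> nat"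
  assumes N: "CARD('s) = CARD('v)" and dom: "dominated (fst \<circ> z) y"
  shows "rel_pmf (\<lambda>z y. dominated (fst \<circ> z) y)
    (bind_pmf (pmf_of_set UNIV) (aff_serve \<rho> z))
    (bind_pmf (pmf_of_set UNIV) (\<lambda>s. return_pmf (y(s := y s - 1))))"
proof (rule rel_pmf_bindI)
  \<comment> \<open>Departures reverse the roles: whenever a JSQ tail drops at a tight level, the
    affinity tail must drop too. The coupling is therefore built from JSQ to affinity and then
    flipped.\<close>
  have "rel_pmf (\<lambda>s v. \<forall>m\<in>tight (fst \<circ> z) y. m \<le> y s \<longrightarrow> m \<le> (fst \<circ> z) v)
      (pmf_of_set UNIV) (pmf_of_set UNIV)"
  proof (rule rel_pmf_thresholds)
    fix m assume "m \<in> tight (fst \<circ> z) y"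
    then show "measure_pmf.prob (pmf_of_set UNIV) {s. m \<le> y s} \<le>
        measure_pmf.prob (pmf_of_set UNIV) {v. m \<le> (fst \<circ> z) v}"
      using tight_Qbar_ge[OF dom] N by (simp add: measure_pmf_of_set Qbar_def divide_right_mono)
  qed
  then show "rel_pmf (\<lambda>v s. \<forall>m\<in>tight (fst \<circ> z) y. m \<le> y s \<longrightarrow> m \<le> (fst \<circ> z) v)
      (pmf_of_set UNIV) (pmf_of_set UNIV)"
    by (subst pmf.rel_flip[symmetric]) (simp add: conversep_iff[abs_def])
next
  fix v s assume "\<forall>m\<in>tight (fst \<circ> z) y. m \<le> y s \<longrightarrow> m \<le> (fst \<circ> z) v"
  then show "rel_pmf (\<lambda>z y. dominated (fst \<circ> z) y) (aff_serve \<rho> z v) (return_pmf (y(s := y s - 1)))"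
    unfolding rel_pmf_return_pmf2 using dominated_decr[OF dom] by (auto dest!: fst_aff_serve)
qed

text \<open>Lumping needs the correct marginals at every pair of states, also at unrelated ones;
  there the independent coupling serves as a default.\<close>

lemma exists_coupled_kernel:
  assumes "\<And>x y. R x y \<Longrightarrow> rel_pmf R (K x) (L y)"
  shows "\<exists>J. \<forall>s. map_pmf fst (J s) = K (fst s) \<and> map_pmf snd (J s) = L (snd s) \<and>
    (R (fst s) (snd s) \<longrightarrow> set_pmf (J s) \<subseteq> {s. R (fst s) (snd s)})"
proof (rule choice, rule allI)
  fix s
  show "\<exists>J. map_pmf fst J = K (fst s) \<and> map_pmf snd J = L (snd s) \<and>
      (R (fst s) (snd s) \<longrightarrow> set_pmf J \<subseteq> {s. R (fst s) (snd s)})"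
  proof (cases "R (fst s) (snd s)")
    case True
    from assms[OF this] show ?thesis
      by (elim rel_pmf.cases) (auto intro!: exI)
  next
    case False
    then show ?thesis
      by (intro exI[of _ "pair_pmf (K (fst s)) (L (snd s))"]) (simp add: map_fst_pair_pmf map_snd_pair_pmf)
  qed
qed

theorem theorem3p3:
  fixes E :: "'v::finite \<Rightarrow> 'v \<Rightarrow> bool"
    and N d k :: nat
    and lam \<mu>\<^sub>1 \<mu>\<^sub>2 :: real
    and \<tau> :: "'v aff_state \<Rightarrow> 'v set \<Rightarrow> 'v pmf"
    and \<sigma> :: "('s::finite \<Rightarrow> nat) \<Rightarrow> 's set \<Rightarrow> 's pmf"
    and z0 :: "'v aff_state"
    and y0 :: "'s \<Rightarrow> nat"
  assumes "CARD('v) = N" and "CARD('s) = N"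
    and "simple_regular_graph d E"
    and "1 \<le> k" and "k \<le> N"
    and "(\<Sum>i = 1..N - d - 1. real ((N - i) choose (k - 1))) < (real d + 1) / real N * real (N choose k)"
    and "0 < lam" and "0 < \<mu>\<^sub>2" and "\<mu>\<^sub>2 < \<mu>\<^sub>1"
    and "aff_tie_rule E \<tau>"
    and "jsq_tie_rule k \<sigma>"
    and "\<forall>m\<ge>1. Qbar_plus (fst \<circ> z0) m \<le> Qbar_plus y0 m"
  shows "aff_tails E \<tau> lam \<mu>\<^sub>1 \<mu>\<^sub>2 z0 \<le>\<^sub>s\<^sub>t jsq_tails k \<sigma> (lam * real N) \<mu>\<^sub>1 y0"
proof -
  \<comment> \<open>The rate of the common clock: \<open>N\<close> arrival streams of rate
    \<open>lam\<close> and \<open>N\<close> potential service streams of rate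
    \<open>\<mu>\<^sub>1\<close>. A ring is an arrival with probability \<open>p\<close>.\<close>
  define c where "c = (lam + \<mu>\<^sub>1) * N"
  define p where "p = lam / (lam + \<mu>\<^sub>1)"
  let ?K = "aff_kernel E \<tau> p (\<mu>\<^sub>2 / \<mu>\<^sub>1)" and ?L = "jsq_kernel k \<sigma> p"
  let ?R = "\<lambda>z y. dominated (fst \<circ> z) y"
  have "0 < N" using assms(1) by auto
  then have c: "0 < c" using assms by (simp add: c_def)
  have "rel_pmf ?R (?K z) (?L y)" if "?R z y" for z y
    unfolding aff_kernel_def jsq_kernel_def
  \<comment> \<open>Both systems use the same coin to decide between arrival and service.\<close>
  proof (rule rel_pmf_bindI[where R="(=)"])
    show "rel_pmf (=) (bernoulli_pmf p) (bernoulli_pmf p)" by (simp add: pmf.rel_eq)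
    note arrival = rel_arrival[where E=E and d=d and k=k and \<tau>=\<tau> and \<sigma>=\<sigma>, OF _ _ _ _ _ _ _ that]
    note departure = rel_departure[OF _ that, of "\<mu>\<^sub>2 / \<mu>\<^sub>1"]
    show "rel_pmf ?R
        (if a then bind_pmf (pmf_of_set UNIV) (\<lambda>v. map_pmf (aff_assign (selection E v) z) (\<tau> z (selection E v)))
         else bind_pmf (pmf_of_set UNIV) (aff_serve (\<mu>\<^sub>2 / \<mu>\<^sub>1) z))
        (if b then bind_pmf (pmf_of_set {S. card S = k}) (\<lambda>S. map_pmf (\<lambda>w. y(w := y w + 1)) (\<sigma> y S))
         else bind_pmf (pmf_of_set UNIV) (\<lambda>v. return_pmf (y(v := y v - 1))))" if "a = b" for a b
      using that arrival departure assms by (cases b) simp_all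
  qed
  then have "\<exists>J. \<forall>s. map_pmf fst (J s) = ?K (fst s) \<and> map_pmf snd (J s) = ?L (snd s) \<and>
      (?R (fst s) (snd s) \<longrightarrow> set_pmf (J s) \<subseteq> {s. ?R (fst s) (snd s)})"
    by (rule exists_coupled_kernel[where R="?R"])
  then obtain J where J: "\<And>s. map_pmf fst (J s) = ?K (fst s)" "\<And>s. map_pmf snd (J s) = ?L (snd s)"
    "\<And>s. ?R (fst s) (snd s) \<Longrightarrow> set_pmf (J s) \<subseteq> {s. ?R (fst s) (snd s)}"
    by blast
  let ?W = "\<lambda>t. traj J (z0, y0) (exp (c * t))"
  have "aff_rate E \<tau> lam \<mu>\<^sub>1 \<mu>\<^sub>2 z z' = c * pmf (?K z) z'" if "z \<noteq> z'" for z z'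
    using aff_rate_eq[of lam \<mu>\<^sub>2 \<mu>\<^sub>1 z z' E \<tau>] that assms by (simp add: c_def p_def)
  from ctmc_traj[of fst J ?K, OF J(1) this c, of "(z0, y0)"]
  have Z: "ctmc noise (\<lambda>t \<omega>. fst (?W t \<omega>)) (aff_rate E \<tau> lam \<mu>\<^sub>1 \<mu>\<^sub>2) z0" by simp
  have "jsq_rate k \<sigma> (lam * N) \<mu>\<^sub>1 y y' = c * pmf (?L y) y'" if "y \<noteq> y'" for y y'
    using jsq_rate_eq[of lam \<mu>\<^sub>1 y y' k \<sigma>] that assms by (simp add: c_def p_def)
  from ctmc_traj[of snd J ?L, OF J(2) this c, of "(z0, y0)"]
  have Y: "ctmc noise (\<lambda>t \<omega>. snd (?W t \<omega>)) (jsq_rate k \<sigma> (lam * N) \<mu>\<^sub>1) y0" by simp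
  \<comment> \<open>The product of uniform laws on sequences; \<open>to_stream\<close> carries it to
    \<open>noise\<close>, so the coupled chain can be read on it.\<close>
  define M where "M = (\<Pi>\<^sub>M i\<in>(UNIV :: nat set). unif01)"
  interpret M: prob_space M
    unfolding M_def by (rule prob_space_PiM) (rule prob_space_unif01)
  have h: "to_stream \<in> M \<rightarrow>\<^sub>M noise"
    unfolding M_def noise_def by (rule measurable_to_stream)
  have noise: "distr M noise to_stream = noise"
    unfolding M_def noise_def by (rule stream_space_eq_distr[symmetric])
  have "AE \<omega> in noise. \<forall>t. ?R (fst (?W t \<omega>)) (snd (?W t \<omega>))"
    using AE_noise
  proof eventually_elim
    case (elim \<omega>)
    have "?W t \<omega> \<in> {s. ?R (fst s) (snd s)}" for t
      by (rule traj_in_rel) (use J(3) elim assms in \<open>auto simp: dominated_def\<close>)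
    then show ?case by simp
  qed
  then have AE: "AE \<omega> in M. \<forall>t. ?R (fst (?W t (to_stream \<omega>))) (snd (?W t (to_stream \<omega>)))"
    by (intro AE_distrD[OF h]) (simp only: noise)
  show ?thesis
    unfolding st_le_def aff_tails_def jsq_tails_def
  proof (intro exI conjI)
    show "prob_space M" by (rule M.prob_space_axioms)
    show "ctmc M (\<lambda>t \<omega>. fst (?W t (to_stream \<omega>))) (aff_rate E \<tau> lam \<mu>\<^sub>1 \<mu>\<^sub>2) z0"
      using Z by (intro ctmc_compose[OF _ M.prob_space_axioms h]) (simp only: noise)
    show "ctmc M (\<lambda>t \<omega>. snd (?W t (to_stream \<omega>))) (jsq_rate k \<sigma> (lam * real N) \<mu>\<^sub>1) y0"
      using Y by (intro ctmc_compose[OF _ M.prob_space_axioms h]) (simp only: noise)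
    show "AE \<omega> in M. \<forall>t\<ge>0. \<forall>m\<ge>1. Qbar_plus (fst \<circ> fst (?W t (to_stream \<omega>))) m \<le>
        Qbar_plus (snd (?W t (to_stream \<omega>))) m"
      using AE by (rule eventually_mono) (simp add: dominated_def)
  qed (rule refl)+
qed

end
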